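(* Let $p,q\in\mathbb{Z}_{\geq 2}$, $n\in\mathbb{Z}_{\geq 1}$, $a\in\{1,-1\}$, and suppose $p+q$ is odd. For $1\le r\le p$ put $$S_r=\sum_{j=1}^\infty \frac{(a^n)^j\,\mathbf{H}_{nj,a}^{(r)}}{j^{p+q-r}}.$$ Then $$\begin{aligned} \int_0^1\frac{\ln^{p-1}(x)\operatorname{Li}_q(ax)}{x(1-x^n)}\,dx=\;&-(p-1)!\sum_{r=1}^{p}\frac{a}{n^{p+q-r}}\binom{p+q-r-1}{p-r}\,S_r\\ &+(p-1)!\sum_{r=2}^{p}\frac{1}{n^{p+q-r}}\binom{p+q-r-1}{p-r}\operatorname{Li}_r(a)\operatorname{Li}_{p+q-r}(a^n)\\ &+(p-1)!\sum_{\ell=2}^{q-1}\frac{(-1)^{\ell}}{n^{p+q-\ell}}\binom{p+q-\ell-1}{q-\ell}\operatorname{Li}_\ell(a)\zeta(p+q-\ell)\\ &-\frac{(p-1)!}{n^{p+q-1}}\binom{p+q-2}{q-1}\operatorname{Li}_1(a)\bigl\{\zeta(p+q-1)-\operatorname{Li}_{p+q-1}(a^n)\bigr\}\\ &-\frac{(-1)^{p}(p-1)!}{n^p}\bigl\{n^p\operatorname{Li}_{p+q}(a)+\operatorname{Li}_q(a)\zeta(p)\bigr\}, \end{aligned}$$ where, for $a=1$, the term containing $\operatorname{Li}_1(a)$ is understood to be $0$ (convention $\operatorname{Li}_1(1)=0$). Here, for each $1\le r\le p$, writing $s=p+q-r$, the sum $S_r$ is given by $$\begin{aligned} S_r=\;&\frac{a}{2}\bigl(1+(-1)^s\bigr)\operatorname{Li}_s(a^n)\operatorname{Li}_r(a)+\frac{a}{2n^r}\operatorname{Li}_{p+q}(1)\\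 &-(-1)^s n^s a\sum_{i=0}^{\lfloor s/2\rfloor}\binom{p+q-2i-1}{r-1}n^{-2i}\operatorname{Li}_{2i}(1)\operatorname{Li}_{p+q-2i}(a)\\ &+\frac{(-1)^r a}{n^r}\sum_{i=0}^{\lfloor r/2\rfloor}\binom{p+q-2i-1}{s-1}\operatorname{Li}_{2i}(1)\operatorname{Li}_{p+q-2i}(a^n)\\ &+\frac{(-1)^r a^{n+1}}{2n^r}\sum_{i=1}^{n-1}\sum_{k=1}^{r}\binom{p+q-k-1}{s-1}a^i(-1)^k\,\Theta(1,k,i,n)\,\Phi\!\left(a^n,p+q-k,\frac{n-i}{n}\right), \end{aligned}$$ with the conventions $\operatorname{Li}_0(1)=-\tfrac12$ and $\operatorname{Li}_1(1)=0$.
   Context: $\zeta(s)=\sum_{m\ge1}m^{-s}$ is the Riemann zeta function. The polylogarithm is $\operatorname{Li}_m(x)=\sum_{k\ge1}x^k/k^m$; at $x=\pm1$, $\operatorname{Li}_m(1)=\zeta(m)$ for $m\ge2$ and $\operatorname{Li}_1(-1)=-\ln 2$, together with the conventions $\operatorname{Li}_0(1)=\zeta(0)=-\tfrac12$ and $\operatorname{Li}_1(1)=0$. $\ln^{p-1}(x)$ means $(\ln x)^{p-1}$. For $a=\pm1$ and $N,r\in\mathbb{Z}_{\ge1}$: $\mathbf{H}_{N,a}^{(r)}=\sum_{j=1}^N \frac{a^{j-1}}{j^r}$. The Lerch transcendent is $\Phi(x,s,t)=\sum_{m=0}^\infty\frac{x^m}{(m+t)^s}$. For integers $k\ge1$ and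 $1\le i\le n-1$: $\Theta(1,1,i,n)=\pi\cot(\pi i/n)$, and for $k\ge2$, $\Theta(1,k,i,n)=\Phi(1,k,\tfrac{i}{n})+(-1)^k\,\Phi(1,k,\tfrac{n-i}{n})$. Empty sums are $0$. *)

theory Defs
  imports "HOL-Analysis.Analysis"
begin

text \<open>The Dirichlet series represents the zeta function for arguments greater than 1 only.\<close>

definition zeta :: "real \<Rightarrow> real" where
  "zeta s = (\<Sum>m. real (Suc m) powr (- s))"

text \<open>The first two branches are the conventions for the two values at 1 where the series
  diverges; the value at order 0 is that of the analytically continued zeta function at 0.\<close>

definition Li :: "nat \<Rightarrow> real \<Rightarrow> real" where
  "Li m x =
    (if x = 1 \<and> m = 0 then - (1 / 2)
     else if x = 1 \<and> m = 1 then 0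
     else (\<Sum>k. x ^ Suc k / real (Suc k) ^ m))"

definition gen_harmonic :: "nat \<Rightarrow> real \<Rightarrow> nat \<Rightarrow> real" where
  "gen_harmonic N a r = (\<Sum>j = 1..N. a ^ (j - 1) / real j ^ r)"

definition Lerch_Phi :: "real \<Rightarrow> nat \<Rightarrow> real \<Rightarrow> real" where
  "Lerch_Phi x s t = (\<Sum>m. x ^ m / (real m + t) ^ s)"

text \<open>\<open>Theta1 k i n\<close> stands for \<open>\<Theta>(1, k, i, n)\<close>, for \<open>k \<ge> 1\<close> and \<open>1 \<le> i \<le> n - 1\<close>.\<close>

definition Theta1 :: "nat \<Rightarrow> nat \<Rightarrow> nat \<Rightarrow> real" where
  "Theta1 k i n =
    (if k = 1 then pi * cot (pi * real i / real n)
     else Lerch_Phi 1 k (real i / real n) + (- 1) ^ k * Lerch_Phi 1 k (real (n - i) / real n))"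

definition euler_term :: "nat \<Rightarrow> nat \<Rightarrow> nat \<Rightarrow> real \<Rightarrow> nat \<Rightarrow> nat \<Rightarrow> real" where
  "euler_term p q n a r j = (a ^ n) ^ j * gen_harmonic (n * j) a r / real j ^ (p + q - r)"

definition euler_sum :: "nat \<Rightarrow> nat \<Rightarrow> nat \<Rightarrow> real \<Rightarrow> nat \<Rightarrow> real" where
  "euler_sum p q n a r = (\<Sum>m. euler_term p q n a r (Suc m))"

end

theory Submission
  imports Defs
begin

text \<open>
  Write \<open>w = p + q\<close> for the odd weight, \<open>s = w - r\<close>, \<open>h(K) = \<Sum>k\<le>K. a ^ k / k ^ r\<close> and
  \<open>N = n * j\<close>, and use that \<open>a ^ k * a ^ k = 1\<close>.

  The evaluation of the Euler sums is a parity argument for the double series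
  \<open>\<Sum>d\<ge>1. \<Sum>j\<in>\<int>. a ^ d / (j ^ s * (j - d / n) ^ r)\<close>, with the poles left out.
  The sign of the lattice index runs over both values, so each row
  \<open>\<plusminus>j\<close> collects \<open>h(N - 1)\<close> from \<open>d < N\<close> and, because \<open>w\<close> is odd, \<open>h(N)\<close> with the
  same sign from the index \<open>-j\<close>: instead of cancelling, the two copies add up to
  twice the Euler sum, apart from a diagonal term and a product of two polylogarithms
  (\<open>lattice_sums_LIMSEQ_by_rows\<close>).  Each column, on the other hand, is a sum over all integers,
  which partial fractions reduce to \<open>\<Sum>j\<in>\<int>. 1 / (j + y) ^ k\<close> for \<open>y = 0\<close> and \<open>y = d / n\<close>.
  This is periodic in \<open>y\<close>, vanishes or equals \<open>2 * \<zeta>(k)\<close> at the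
  integers and is \<open>\<Theta>(1, k, i, n)\<close> at \<open>i / n\<close>; for \<open>k = 1\<close> it is the partial fraction
  expansion of the cotangent.  Sorting the columns by \<open>d mod n\<close> then produces the polylogarithms
  and the Lerch values (\<open>lattice_sums_LIMSEQ_by_columns\<close>).

  The double series diverges for \<open>a = 1\<close>, \<open>r = 1\<close>.  It is therefore cut off at
  \<open>d \<le> D\<close> and a multiple of \<open>h(D)\<close> is added, after which the limit \<open>D \<rightarrow> \<infinity>\<close> may be taken
  inside the sum over rows by dominated convergence; on the side of the columns the
  harmonic numbers cancel exactly, which is the meaning of the convention \<open>Li 1 1 = 0\<close>.

  For the integral, expand \<open>1 / (1 - x ^ n)\<close> and \<open>Li q\<close> and integrate
  \<open>x ^ m * ln x ^ c\<close> termwise.  This gives the absolutely convergent double series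
  \<open>\<Sum>j\<ge>0. \<Sum>k\<ge>1. a ^ k / (k ^ q * (k + n * j) ^ p)\<close>.  The row \<open>j = 0\<close> is
  \<open>Li (p + q) a\<close>; in the other rows partial fractions in \<open>k\<close> leave complete
  polylogarithms and their tails \<open>Li r a - h(N)\<close>, and summing the latter over \<open>j\<close> yields the
  Euler sums (\<open>shifted_Li_series_eq\<close>).
\<close>

section \<open>Truncated polylogarithms at the points 1 and -1\<close>

definition Li_trunc :: "nat \<Rightarrow> real \<Rightarrow> nat \<Rightarrow> real" where
  "Li_trunc m x K = (\<Sum>k = 1..K. x ^ k / real k ^ m)"

lemma Li_trunc_0 [simp]: "Li_trunc m x 0 = 0"
  by (simp add: Li_trunc_def)

lemma Li_trunc_Suc [simp]:
  "Li_trunc m x (Suc K) = Li_trunc m x K + x ^ Suc K / real (Suc K) ^ m"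
  by (simp add: Li_trunc_def)

lemma sums_Suc_iff_LIMSEQ:
  fixes f :: "nat \<Rightarrow> real"
  shows "(\<lambda>m. f (Suc m)) sums L \<longleftrightarrow> (\<lambda>K. \<Sum>k = 1..K. f k) \<longlonglongrightarrow> L"
  by (simp add: sums_def sum.atLeast1_atMost_eq)

lemma sign_powers:
  fixes a :: real
  assumes "a \<in> {1, - 1}"
  shows "\<bar>a ^ k\<bar> = 1" "a ^ k * a ^ k = 1" "a * a = 1" "a \<noteq> 0" "a ^ k \<in> {1, - 1}"
proof -
  have "a ^ k = 1 \<or> a ^ k = - 1"
    using assms by (cases "even k") auto
  then show "\<bar>a ^ k\<bar> = 1" "a ^ k * a ^ k = 1" "a * a = 1" "a \<noteq> 0" "a ^ k \<in> {1, - 1}"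
    using assms by auto
qed

lemma summable_inverse_Suc_power:
  assumes "m \<ge> 2"
  shows "summable (\<lambda>k. 1 / real (Suc k) ^ m)"
proof -
  have "summable (\<lambda>k. inverse (real k ^ m))"
    using inverse_power_summable[of m] assms by (simp add: power_inverse)
  then show ?thesis
    by (subst (asm) summable_Suc_iff[symmetric]) (simp add: inverse_eq_divide)
qed

lemma Li_sums:
  fixes a :: real
  assumes a: "a \<in> {1, - 1}" and m: "m \<ge> 2 \<or> m = 1 \<and> a = - 1"
  shows "(\<lambda>k. a ^ Suc k / real (Suc k) ^ m) sums Li m a"
proof -
  have "summable (\<lambda>k. a ^ Suc k / real (Suc k) ^ m)"
  proof (cases "m \<ge> 2")
    case True
    show ?thesis
      by (rule summable_comparison_test'[OF summable_inverse_Suc_power[OF True], of 0])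
         (use sign_powers[OF a] in \<open>auto simp: abs_mult power_abs simp del: power_Suc\<close>)
  next
    case False
    then have "m = 1" "a = - 1" using m by auto
    then show ?thesis
      using summable_minus[OF sums_summable[OF alternating_harmonic_series_sums]] by simp
  qed
  moreover have "Li m a = (\<Sum>k. a ^ Suc k / real (Suc k) ^ m)"
    using m by (auto simp: Li_def)
  ultimately show ?thesis by (simp add: summable_sums)
qed

lemma Li_trunc_LIMSEQ:
  fixes a :: real
  assumes "a \<in> {1, - 1}" and "m \<ge> 2 \<or> m = 1 \<and> a = - 1"
  shows "Li_trunc m a \<longlonglongrightarrow> Li m a"
  using Li_sums[OF assms] unfolding sums_Suc_iff_LIMSEQ[of "\<lambda>k. a ^ k / real k ^ m"]
  by (simp add: Li_trunc_def[abs_def])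

lemma sums_inverse_power:
  assumes "m \<ge> 2"
  shows "(\<lambda>k. 1 / real (Suc k) ^ m) sums Li m 1"
  using Li_sums[of 1 m] assms by simp

lemma zeta_eq_Li:
  assumes "m \<ge> 2"
  shows "zeta (real m) = Li m 1"
  using assms by (simp add: zeta_def Li_def powr_minus powr_realpow inverse_eq_divide)

text \<open>A single bound for all exponents \<open>m \<ge> 1\<close>: it is weak enough to hold for
  the harmonic series, and strong enough to leave \<open>\<Sum> sqrt N / N ^ s\<close> convergent for \<open>s = 2\<close>.
  The increments are at most \<open>1 / N \<le> 2 * (sqrt N - sqrt (N - 1))\<close>.\<close>

lemma Li_trunc_diff_bound:
  fixes a :: real
  assumes a: "a \<in> {1, - 1}" and m: "m \<ge> 1"
  shows "\<bar>Li_trunc m a (K + N) - Li_trunc m a K\<bar> \<le> 2 * sqrt (real N)"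
proof (induction N)
  case (Suc N)
  have 1: "\<bar>a ^ Suc (K + N) / real (Suc (K + N)) ^ m\<bar> = 1 / real (Suc (K + N)) ^ m"
    using sign_powers(1)[OF a, of "Suc (K+N)"] by (simp add: abs_mult del: power_Suc)
  have "real (Suc N) \<le> real (Suc (K + N)) ^ m"
    using self_le_power[of "real (Suc (K + N))" m] m by simp
  then have 2: "1 / real (Suc (K + N)) ^ m \<le> 1 / real (Suc N)"
    by (intro divide_left_mono) auto
  have 3: "1 / real (Suc N) \<le> 2 * (sqrt (real (Suc N)) - sqrt (real N))"
  proof -
    define u where "u = sqrt (real (Suc N))"
    define v where "v = sqrt (real N)"
    have u: "u * u = 1 + real N" and v: "v * v = real N" by (simp_all add: u_def v_def)
    have uv: "v \<le> u" "u \<ge> 1" "v \<ge> 0" by (simp_all add: u_def v_def)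
    have "(u - v) * (u + v) = 1" using u v by (simp add: algebra_simps)
    moreover have "u * 1 \<le> u * u"
      using uv by (intro mult_left_mono) auto
    then have "u + v \<le> 2 * (u * u)"
      using uv by linarith
    ultimately have "1 \<le> (u - v) * (2 * (u * u))"
      using uv mult_left_mono[of "u+v" "2*(u*u)" "u - v"] by simp
    then have "1 / (u * u) \<le> 2 * (u - v)"
      using uv by (simp add: field_simps)
    then show ?thesis using u by (simp add: u_def v_def)
  qed
  have "Li_trunc m a (K + Suc N) - Li_trunc m a K
      = (Li_trunc m a (K + N) - Li_trunc m a K) + a ^ Suc (K + N) / real (Suc (K + N)) ^ m"
    by simp
  then have "\<bar>Li_trunc m a (K + Suc N) - Li_trunc m a K\<bar>
      \<le> \<bar>Li_trunc m a (K + N) - Li_trunc m a K\<bar> + \<bar>a ^ Suc (K + N) / real (Suc (K + N)) ^ m\<bar>"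
    by (simp only: abs_triangle_ineq)
  also have "\<dots> \<le> 2 * sqrt (real N) + 1 / real (Suc N)"
    using Suc 2 unfolding 1 by (intro add_mono)
  also have "\<dots> \<le> 2 * sqrt (real (Suc N))"
    using 3 by argo
  finally show ?case .
qed simp

lemma Li_trunc_bound:
  fixes a :: real
  assumes "a \<in> {1, - 1}" and "m \<ge> 1"
  shows "\<bar>Li_trunc m a N\<bar> \<le> 2 * sqrt (real N)"
  using Li_trunc_diff_bound[OF assms, of 0 N] by simp

lemma inverse_power_LIMSEQ_0:
  assumes "m \<ge> 1"
  shows "(\<lambda>K. 1 / real (Suc K) ^ m) \<longlonglongrightarrow> 0"
proof -
  have "(\<lambda>K. (1 / real (Suc K)) ^ m) \<longlonglongrightarrow> 0 ^ m"
    using LIMSEQ_inverse_real_of_nat by (intro tendsto_power) (simp add: inverse_eq_divide)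
  then show ?thesis using assms by (simp add: power_divide zero_power)
qed

lemma Li_trunc_shift_LIMSEQ:
  fixes a :: real
  assumes a: "a \<in> {1, - 1}" and m: "m \<ge> 1"
  shows "(\<lambda>K. Li_trunc m a (K + N) - Li_trunc m a K) \<longlonglongrightarrow> 0"
proof (induction N)
  case (Suc N)
  have "(\<lambda>K. 1 / real (Suc (K + N)) ^ m) \<longlonglongrightarrow> 0"
    using LIMSEQ_ignore_initial_segment[OF inverse_power_LIMSEQ_0[OF m], of N] by simp
  then have "(\<lambda>K. a ^ Suc (K + N) / real (Suc (K + N)) ^ m) \<longlonglongrightarrow> 0"
    by (rule Lim_null_comparison[rotated])
       (use sign_powers(1)[OF a] in \<open>auto simp: abs_mult simp del: power_Suc\<close>)
  from tendsto_add[OF Suc this] show ?case by (simp add: algebra_simps)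
qed simp

lemma summable_sqrt_over_power:
  assumes "s \<ge> 2"
  shows "summable (\<lambda>j. sqrt (real (Suc j)) / real (Suc j) ^ s)"
proof -
  have "summable (\<lambda>j. real j powr (- 3 / 2))"
    by (simp add: summable_real_powr_iff)
  then have "summable (\<lambda>j. real (Suc j) powr (- 3 / 2))"
    by (subst summable_Suc_iff)
  then show ?thesis
  proof (rule summable_comparison_test'[of _ 0], goal_cases)
    case (1 j)
    define x where "x = real (Suc j)"
    have x: "x \<ge> 1" by (simp add: x_def)
    have "x powr 2 \<le> x ^ s"
      using power_increasing[OF assms x] x by (simp add: powr_numeral)
    then have "sqrt x / x ^ s \<le> x powr (1/2) / x powr 2"
      using x by (simp add: powr_half_sqrt frac_le)
    also have "\<dots> = x powr (- 3 / 2)"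
      by (simp flip: powr_diff)
    finally show ?case using x by (simp add: x_def)
  qed
qed

lemma gen_harmonic_eq_Li_trunc:
  fixes a :: real
  assumes a: "a \<in> {1, - 1}"
  shows "gen_harmonic N a r = a * Li_trunc r a N"
proof -
  have "a ^ (j - 1) = a * a ^ j" if "j \<in> {1..N}" for j
    using that sign_powers(3)[OF a] by (cases j) (auto simp: mult.assoc[symmetric])
  then show ?thesis
    unfolding gen_harmonic_def Li_trunc_def sum_distrib_left
    by (intro sum.cong refl) (metis times_divide_eq_right)
qed

section \<open>Partial fractions\<close>

lemma sum_binomial_powers_step:
  fixes b :: real
  assumes "r \<ge> 1"
  shows "(1 - b) * (\<Sum>k<r. real ((s + k) choose k) * b ^ k)
    = (\<Sum>k<r. real ((s + k - 1) choose k) * b ^ k) - real ((s + r - 1) choose (r - 1)) * b ^ r"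
  using assms
proof (induction r rule: dec_induct)
  case base
  show ?case by (cases s) auto
next
  case (step m)
  define C where "C = real ((s + m - 1) choose (m - 1))"
  define C' where "C' = real ((s + m - 1) choose m)"
  obtain m' where m: "m = Suc m'" using step by (cases m) auto
  have "real ((s + m) choose m) = C' + C"
    using m by (simp add: C_def C'_def)
  moreover have "(1 - b) * (\<Sum>k<m. real ((s + k) choose k) * b ^ k)
      = (\<Sum>k<m. real ((s + k - 1) choose k) * b ^ k) - C * b ^ m"
    using step.IH by (simp only: C_def)
  moreover have expand: "(1 - b) * (X + (C' + C) * b ^ m) = Y + C' * b ^ m - (C' + C) * b ^ Suc m"
    if "(1 - b) * X = Y - C * b ^ m" for X Y
  proof -
    have "(1 - b) * (X + (C' + C) * b ^ m) = (1 - b) * X + (1 - b) * ((C' + C) * b ^ m)"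
      by (rule distrib_left)
    also have "\<dots> = Y + C' * b ^ m - (C' + C) * b ^ Suc m"
      unfolding that by (simp add: algebra_simps)
    finally show ?thesis .
  qed
  ultimately have "(1 - b) * ((\<Sum>k<m. real ((s + k) choose k) * b ^ k) + real ((s + m) choose m) * b ^ m)
      = (\<Sum>k<m. real ((s + k - 1) choose k) * b ^ k) + C' * b ^ m - real ((s + m) choose m) * b ^ Suc m"
    by simp
  then show ?case unfolding sum.lessThan_Suc C'_def by simp
qed

text \<open>For \<open>0 < \<alpha> < 1\<close> the two summands are the probabilities that, in independent trials with
  success probability \<open>\<alpha>\<close>, success number \<open>s\<close> precedes failure number \<open>r\<close> and conversely.
  Algebraically, raising \<open>s\<close> by one moves a multiple of \<open>\<alpha> ^ s * \<beta> ^ r\<close> from the first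
  summand to the second.\<close>

lemma binomial_first_passage_identity:
  fixes \<alpha> \<beta> :: real
  assumes "\<alpha> + \<beta> = 1" and r: "r \<ge> 1"
  shows "\<alpha> ^ s * (\<Sum>k<r. real ((s + k - 1) choose k) * \<beta> ^ k)
       + \<beta> ^ r * (\<Sum>k<s. real ((r + k - 1) choose k) * \<alpha> ^ k) = 1"
proof (induction s)
  case 0
  have "(\<Sum>k<r. real ((k - 1) choose k) * \<beta> ^ k) = (\<Sum>k<r. if k = 0 then 1 else 0)"
    by (intro sum.cong) (auto simp: binomial_eq_0)
  also have "\<dots> = 1" using r by (simp add: sum.delta)
  finally show ?case by simp
next
  case (Suc s)
  have \<alpha>: "\<alpha> = 1 - \<beta>" using assms by simp
  have "\<alpha> ^ Suc s * (\<Sum>k<r. real ((Suc s + k - 1) choose k) * \<beta> ^ k)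
      = \<alpha> ^ s * ((1 - \<beta>) * (\<Sum>k<r. real ((s + k) choose k) * \<beta> ^ k))"
    using \<alpha> by simp
  also note sum_binomial_powers_step[OF r]
  finally have 1: "\<alpha> ^ Suc s * (\<Sum>k<r. real ((Suc s + k - 1) choose k) * \<beta> ^ k)
      = \<alpha> ^ s * (\<Sum>k<r. real ((s + k - 1) choose k) * \<beta> ^ k)
        - real ((s + r - 1) choose (r - 1)) * \<alpha> ^ s * \<beta> ^ r"
    by (simp add: algebra_simps)
  have "s + r - 1 - (r - 1) = s" using r by simp
  then have 2: "(s + r - 1) choose (r - 1) = (r + s - 1) choose s"
    using binomial_symmetric[of "r - 1" "s + r - 1"] r by (simp add: add.commute)
  have "\<beta> ^ r * (\<Sum>k<Suc s. real ((r + k - 1) choose k) * \<alpha> ^ k)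
      = \<beta> ^ r * (\<Sum>k<s. real ((r + k - 1) choose k) * \<alpha> ^ k)
        + real ((s + r - 1) choose (r - 1)) * \<alpha> ^ s * \<beta> ^ r"
    unfolding 2 sum.lessThan_Suc distrib_left by simp
  with 1 Suc show ?case by linarith
qed

lemma sum_reverse_1:
  fixes f :: "nat \<Rightarrow> real"
  shows "(\<Sum>k<r. f k) = (\<Sum>k = 1..r. f (r - k))"
proof -
  have "(\<Sum>k<r. f k) = (\<Sum>k<r. f (r - Suc k))"
    by (rule sum.nat_diff_reindex[symmetric])
  also have "\<dots> = (\<Sum>k = 1..r. f (r - k))"
    by (simp add: sum.atLeast1_atMost_eq)
  finally show ?thesis .
qed

lemma partial_fractions_unit:
  fixes \<alpha> \<beta> :: real
  assumes "\<alpha> + \<beta> = 1" and "\<alpha> \<noteq> 0" "\<beta> \<noteq> 0" and r: "r \<ge> 1" and s: "s \<ge> 1"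
  shows "1 / (\<alpha> ^ s * \<beta> ^ r) = (\<Sum>k = 1..s. real ((s + r - k - 1) choose (r - 1)) / \<alpha> ^ k)
      + (\<Sum>k = 1..r. real ((s + r - k - 1) choose (s - 1)) / \<beta> ^ k)"
proof -
  have aux: "\<beta> ^ (r - k) / \<beta> ^ r = 1 / \<beta> ^ k" if "k \<le> r" "\<beta> \<noteq> 0" for \<beta> :: real and k r :: nat
    using that by (simp add: power_diff)
  have half: "(\<Sum>k<r. real ((s + k - 1) choose k) * \<beta> ^ k) / \<beta> ^ r
        = (\<Sum>k = 1..r. real ((s + r - k - 1) choose (s - 1)) / \<beta> ^ k)"
    if "\<beta> \<noteq> 0" "r \<ge> 1" "s \<ge> 1" for \<beta> :: real and r s :: nat
    unfolding sum_reverse_1 sum_divide_distrib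
  proof (intro sum.cong refl)
    fix k assume k: "k \<in> {1..r}"
    have "(s + (r - k) - 1) choose (r - k) = (s + r - k - 1) choose (s - 1)"
      using binomial_symmetric[of "r - k" "s + (r - k) - 1"] k that by simp
    then show "real ((s + (r - k) - 1) choose (r - k)) * \<beta> ^ (r - k) / \<beta> ^ r
        = real ((s + r - k - 1) choose (s - 1)) / \<beta> ^ k"
      using aux[of k r \<beta>] k that by (simp add: field_simps)
  qed
  have "1 / (\<alpha> ^ s * \<beta> ^ r) = (\<alpha> ^ s * (\<Sum>k<r. real ((s + k - 1) choose k) * \<beta> ^ k)
       + \<beta> ^ r * (\<Sum>k<s. real ((r + k - 1) choose k) * \<alpha> ^ k)) / (\<alpha> ^ s * \<beta> ^ r)"
    by (simp only: binomial_first_passage_identity[OF assms(1) r])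
  also have "\<dots> = (\<Sum>k<r. real ((s + k - 1) choose k) * \<beta> ^ k) / \<beta> ^ r
       + (\<Sum>k<s. real ((r + k - 1) choose k) * \<alpha> ^ k) / \<alpha> ^ s"
    using assms(2,3) by (simp add: add_divide_distrib)
  also have "\<dots> = (\<Sum>k = 1..s. real ((s + r - k - 1) choose (r - 1)) / \<alpha> ^ k)
      + (\<Sum>k = 1..r. real ((s + r - k - 1) choose (s - 1)) / \<beta> ^ k)"
    using half[of \<beta> r s] half[of \<alpha> s r] assms by (simp add: add.commute)
  finally show ?thesis .
qed

lemma partial_fractions:
  fixes x y :: real
  assumes "x \<noteq> 0" "x \<noteq> y" "y \<noteq> 0" and r: "r \<ge> 1" and s: "s \<ge> 1"
  shows "1 / (x ^ s * (x - y) ^ r)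
    = (- 1) ^ r * (\<Sum>k = 1..s. real ((s + r - k - 1) choose (r - 1)) / y ^ (s + r - k) * (1 / x ^ k))
    + (- 1) ^ r * (\<Sum>k = 1..r. real ((s + r - k - 1) choose (s - 1)) / y ^ (s + r - k)
        * ((- 1) ^ k / (x - y) ^ k))"
proof -
  define \<alpha> where "\<alpha> = x / y"
  define \<beta> where "\<beta> = - ((x - y) / y)"
  have ab: "\<alpha> + \<beta> = 1" "\<alpha> \<noteq> 0" "\<beta> \<noteq> 0"
    using assms by (auto simp: \<alpha>_def \<beta>_def field_simps)
  have pw: "\<beta> ^ k = (- 1) ^ k * (x - y) ^ k / y ^ k" for k
    unfolding \<beta>_def by (subst power_minus) (simp add: power_divide)
  have sg: "(-1::real) ^ k * (-1) ^ k = 1" for k by (simp flip: power_mult_distrib)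
  have "1 / (x ^ s * (x - y) ^ r) = (- 1) ^ r / y ^ (s + r) * (1 / (\<alpha> ^ s * \<beta> ^ r))"
    using assms sg[of r] by (simp add: pw \<alpha>_def power_divide power_add field_simps)
  also have "1 / (\<alpha> ^ s * \<beta> ^ r) = (\<Sum>k = 1..s. real ((s + r - k - 1) choose (r - 1)) / \<alpha> ^ k)
      + (\<Sum>k = 1..r. real ((s + r - k - 1) choose (s - 1)) / \<beta> ^ k)"
    by (rule partial_fractions_unit[OF ab r s])
  also have "(- 1) ^ r / y ^ (s + r) * \<dots> =
     (- 1) ^ r * ((\<Sum>k = 1..s. real ((s + r - k - 1) choose (r - 1)) / \<alpha> ^ k) / y ^ (s + r))
   + (- 1) ^ r * ((\<Sum>k = 1..r. real ((s + r - k - 1) choose (s - 1)) / \<beta> ^ k) / y ^ (s + r))"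
    by (simp add: ring_distribs add_divide_distrib)
  also have "(\<Sum>k = 1..s. real ((s + r - k - 1) choose (r - 1)) / \<alpha> ^ k) / y ^ (s + r)
      = (\<Sum>k = 1..s. real ((s + r - k - 1) choose (r - 1)) / y ^ (s + r - k) * (1 / x ^ k))"
    unfolding sum_divide_distrib
    by (intro sum.cong refl) (use assms in \<open>simp add: \<alpha>_def power_divide power_diff field_simps\<close>)
  also have "(\<Sum>k = 1..r. real ((s + r - k - 1) choose (s - 1)) / \<beta> ^ k) / y ^ (s + r)
      = (\<Sum>k = 1..r. real ((s + r - k - 1) choose (s - 1)) / y ^ (s + r - k) * ((- 1) ^ k / (x - y) ^ k))"
    unfolding sum_divide_distrib
  proof (intro sum.cong refl)
    fix k assume k: "k \<in> {1..r}"
    have "1 / \<beta> ^ k = y ^ k * ((-1) ^ k / (x - y) ^ k)"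
      using assms sg[of k] by (simp add: pw field_simps)
    moreover have "y ^ (s + r) = y ^ (s + r - k) * y ^ k"
      using k by (simp flip: power_add)
    moreover have "real C / \<beta> ^ k / Y = real C * (1 / \<beta> ^ k) / Y" for C Y by simp
    ultimately show "real ((s + r - k - 1) choose (s - 1)) / \<beta> ^ k / y ^ (s + r)
       = real ((s + r - k - 1) choose (s - 1)) / y ^ (s + r - k) * ((- 1) ^ k / (x - y) ^ k)"
      using assms by simp
  qed
  finally show ?thesis .
qed

lemma sum_binomial_hockey_stick:
  assumes "s \<ge> 1"
  shows "(\<Sum>k = 1..r. real ((s + r - k - 1) choose (s - 1))) = real ((s + r - 1) choose s)"
proof (induction r)
  case 0
  then show ?case using assms by (simp add: binomial_eq_0)
next
  case (Suc r)
  have "(\<Sum>k = 1..Suc r. real ((s + Suc r - k - 1) choose (s - 1)))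
      = real ((s + r - 1) choose (s - 1)) + (\<Sum>k = 1..r. real ((s + r - k - 1) choose (s - 1)))"
    unfolding One_nat_def sum.atLeast1_atMost_eq sum.lessThan_Suc_shift by simp
  moreover have "(s + r) choose s = ((s + r - 1) choose s) + ((s + r - 1) choose (s - 1))"
    using assms by (cases s) auto
  ultimately show ?case using Suc by simp
qed

text \<open>The convention \<open>1 / 0 = 0\<close> drops the two poles \<open>x = 0\<close> and \<open>x = y\<close> from the left side
  and only one pole from each sum on the right; the last two terms correct for that.\<close>

lemma partial_fractions_total:
  fixes x y :: real
  assumes "y \<noteq> 0" and r: "r \<ge> 1" and s: "s \<ge> 1"
  shows "1 / (x ^ s * (x - y) ^ r)
    = (- 1) ^ r * (\<Sum>k = 1..s. real ((s + r - k - 1) choose (r - 1)) / y ^ (s + r - k) * (1 / x ^ k))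
    + (- 1) ^ r * (\<Sum>k = 1..r. real ((s + r - k - 1) choose (s - 1)) / y ^ (s + r - k)
        * ((- 1) ^ k / (x - y) ^ k))
    - (- 1) ^ r * real ((s + r - 1) choose s) / y ^ (s + r) * (if x = 0 then 1 else 0)
    - (- 1) ^ r * real ((s + r - 1) choose r) / y ^ (s + r) * (if x = y then 1 else 0)"
proof -
  have yk: "c / y ^ (s + r - k) * (1 / y ^ k) = c / y ^ (s + r)" if "k \<le> s + r" for c k
    using that \<open>y \<noteq> 0\<close> by (simp flip: power_add)
  consider "x = 0" | "x = y" | "x \<noteq> 0" "x \<noteq> y" by blast
  then show ?thesis
  proof cases
    case 1
    have sg: "(-1::real) ^ k / (- y) ^ k = 1 / y ^ k" for k
      by (subst power_minus[of y]) (simp add: power_minus')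
    have "(\<Sum>k = 1..r. real ((s + r - k - 1) choose (s - 1)) / y ^ (s + r - k) * ((- 1) ^ k / (0 - y) ^ k))
        = (\<Sum>k = 1..r. real ((s + r - k - 1) choose (s - 1))) / y ^ (s + r)"
      unfolding sum_divide_distrib by (intro sum.cong refl) (simp only: sg diff_0, rule yk, simp)
    moreover have "(\<Sum>k = 1..s. real ((s + r - k - 1) choose (r - 1)) / y ^ (s + r - k) * (1 / 0 ^ k)) = 0"
      by (intro sum.neutral) (simp add: zero_power)
    ultimately show ?thesis
      using 1 assms sum_binomial_hockey_stick[OF s, of r] by (simp add: zero_power)
  next
    case 2
    have "(\<Sum>k = 1..s. real ((s + r - k - 1) choose (r - 1)) / y ^ (s + r - k) * (1 / y ^ k))
        = (\<Sum>k = 1..s. real ((s + r - k - 1) choose (r - 1))) / y ^ (s + r)"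
      unfolding sum_divide_distrib by (intro sum.cong refl yk) simp
    moreover have "(\<Sum>k = 1..r. real ((s + r - k - 1) choose (s - 1)) / y ^ (s + r - k) * ((- 1) ^ k / 0 ^ k)) = 0"
      by (intro sum.neutral) (simp add: zero_power)
    ultimately show ?thesis
      using 2 assms sum_binomial_hockey_stick[OF r, of s] by (simp add: zero_power add.commute)
  next
    case 3
    then show ?thesis using partial_fractions[OF 3 assms] by simp
  qed
qed

section \<open>Symmetric sums over the integers\<close>

text \<open>Summation over \<open>-J, \<dots>, J\<close>: the limit exists also for the conditionally
  convergent sums with exponent 1.\<close>

definition symmetric_sum :: "(real \<Rightarrow> real) \<Rightarrow> nat \<Rightarrow> real" where
  "symmetric_sum f J = f 0 + (\<Sum>j = 1..J. f (real j) + f (- real j))"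

lemma symmetric_sum_0 [simp]: "symmetric_sum f 0 = f 0"
  by (simp add: symmetric_sum_def)

lemma symmetric_sum_Suc [simp]:
  "symmetric_sum f (Suc J) = symmetric_sum f J + f (real (Suc J)) + f (- real (Suc J))"
  by (simp add: symmetric_sum_def)

text \<open>Only the two ends of the window change, so principal sums are periodic in the shift.\<close>

lemma symmetric_sum_shift:
  "symmetric_sum (\<lambda>x. f (x + 1)) J = symmetric_sum f J + f (real J + 1) - f (- real J)"
  by (induction J) (simp_all add: algebra_simps)

lemma symmetric_sum_uminus: "symmetric_sum (\<lambda>x. f (- x)) J = symmetric_sum f J"
  by (simp add: symmetric_sum_def add.commute)

lemma symmetric_sum_cmult: "symmetric_sum (\<lambda>x. c * f x) J = c * symmetric_sum f J"
  by (simp add: symmetric_sum_def sum_distrib_left ring_distribs)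

lemma symmetric_sum_add:
  "symmetric_sum (\<lambda>x. f x + g x) J = symmetric_sum f J + symmetric_sum g J"
  by (simp add: symmetric_sum_def sum.distrib)

lemma symmetric_sum_diff:
  "symmetric_sum (\<lambda>x. f x - g x) J = symmetric_sum f J - symmetric_sum g J"
  by (simp add: symmetric_sum_def sum.distrib sum_subtractf)

lemma symmetric_sum_sum:
  "symmetric_sum (\<lambda>x. \<Sum>k\<in>A. f k x) J = (\<Sum>k\<in>A. symmetric_sum (f k) J)"
  by (induction J) (simp_all add: sum.distrib)

definition has_principal_sum :: "nat \<Rightarrow> real \<Rightarrow> real \<Rightarrow> bool" where
  "has_principal_sum k y L \<longleftrightarrow> symmetric_sum (\<lambda>x. 1 / (x + y) ^ k) \<longlonglongrightarrow> L"

lemma inverse_shifted_power_LIMSEQ_0: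
  fixes y :: real
  assumes "k \<ge> 1"
  shows "(\<lambda>J. 1 / (real J + y) ^ k) \<longlonglongrightarrow> 0"
proof -
  have "filterlim (\<lambda>J. real J + y) at_infinity sequentially"
    using filterlim_tendsto_add_at_top[OF tendsto_const[of y] filterlim_real_sequentially]
    by (intro filterlim_at_top_imp_at_infinity) (simp add: add.commute)
  then have "(\<lambda>J. inverse (real J + y)) \<longlonglongrightarrow> 0"
    by (rule filterlim_compose[OF tendsto_inverse_0])
  then have "(\<lambda>J. inverse (real J + y) ^ k) \<longlonglongrightarrow> 0 ^ k"
    by (rule tendsto_power)
  moreover have "inverse z ^ k = 1 / z ^ k" for z :: real
    by (simp add: divide_inverse power_inverse)
  ultimately show ?thesis using assms by (simp add: zero_power)
qed

lemma has_principal_sum_shift: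
  assumes "has_principal_sum k y L" and k: "k \<ge> 1"
  shows "has_principal_sum k (y + real c) L"
proof (induction c)
  case 0
  then show ?case using assms by simp
next
  case (Suc c)
  let ?f = "\<lambda>x. 1 / (x + (y + real c)) ^ k"
  have "(\<lambda>J. 1 / (- real J + z) ^ k) = (\<lambda>J. (- 1) ^ k * (1 / (real J + (- z)) ^ k))" for z :: real
  proof
    fix J
    have "(- real J + z) ^ k = (-1) ^ k * (real J + - z) ^ k"
      by (simp flip: power_mult_distrib)
    then show "1 / (- real J + z) ^ k = (- 1) ^ k * (1 / (real J + (- z)) ^ k)"
      by (simp add: power_minus' divide_simps)
  qed
  then have neg: "(\<lambda>J. 1 / (- real J + z) ^ k) \<longlonglongrightarrow> 0" for z :: real
    using tendsto_mult_right_zero[OF inverse_shifted_power_LIMSEQ_0[OF k, of "- z"]] by simp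
  have "(\<lambda>J. symmetric_sum ?f J + ?f (real J + 1) - ?f (- real J)) \<longlonglongrightarrow> L + 0 - 0"
    using Suc inverse_shifted_power_LIMSEQ_0[OF k, of "1 + (y + real c)"] neg[of "y + real c"]
    unfolding has_principal_sum_def by (intro tendsto_diff tendsto_add) (simp_all add: add.assoc)
  also have "(\<lambda>J. symmetric_sum ?f J + ?f (real J + 1) - ?f (- real J))
      = symmetric_sum (\<lambda>x. ?f (x + 1))"
    using symmetric_sum_shift[of ?f] by (simp add: fun_eq_iff)
  also have "\<dots> = symmetric_sum (\<lambda>x. 1 / (x + (y + real (Suc c))) ^ k)"
    by (simp add: algebra_simps)
  finally show ?case by (simp add: has_principal_sum_def)
qed

lemma has_principal_sum_uminus:
  assumes "has_principal_sum k y L"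
  shows "has_principal_sum k (- y) ((- 1) ^ k * L)"
proof -
  have eq: "1 / (x + - y) ^ k = (- 1) ^ k * (1 / (- x + y) ^ k)" for x
  proof -
    have "(x + - y) ^ k = (-1) ^ k * (- x + y) ^ k"
      by (simp flip: power_mult_distrib)
    then show ?thesis by (simp add: power_minus' divide_simps)
  qed
  have "symmetric_sum (\<lambda>x. 1 / (x + - y) ^ k)
      = (\<lambda>J. (- 1) ^ k * symmetric_sum (\<lambda>x. 1 / (x + y) ^ k) J)"
    unfolding eq symmetric_sum_cmult
    using symmetric_sum_uminus[of "\<lambda>x. 1 / (x + y) ^ k"] by (simp add: fun_eq_iff)
  then show ?thesis
    using assms by (simp add: has_principal_sum_def tendsto_mult_left)
qed

lemma has_principal_sum_0:
  assumes "k \<ge> 1"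
  shows "has_principal_sum k 0 ((1 + (- 1) ^ k) * Li k 1)"
proof -
  have "symmetric_sum (\<lambda>x. 1 / (x + 0) ^ k) = (\<lambda>J. (1 + (- 1) ^ k) * (\<Sum>j = 1..J. 1 / real j ^ k))"
  proof
    fix J
    have "1 / real j ^ k + 1 / (- real j) ^ k = (1 + (- 1) ^ k) * (1 / real j ^ k)" for j
      by (cases "even k") simp_all
    then show "symmetric_sum (\<lambda>x. 1 / (x + 0) ^ k) J = (1 + (- 1) ^ k) * (\<Sum>j = 1..J. 1 / real j ^ k)"
      using assms by (simp add: symmetric_sum_def zero_power sum_distrib_left)
  qed
  moreover have "(\<lambda>J. (1 + (- 1) ^ k) * (\<Sum>j = 1..J. 1 / real j ^ k))
      \<longlonglongrightarrow> (1 + (- 1) ^ k) * Li k 1"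
  proof (cases "k = 1")
    case False
    then show ?thesis
      using sums_inverse_power[of k] assms
      unfolding sums_Suc_iff_LIMSEQ[of "\<lambda>j. 1 / real j ^ k"] by (intro tendsto_mult_left) simp
  qed simp
  ultimately show ?thesis by (simp add: has_principal_sum_def)
qed

section \<open>Principal sums at rational points\<close>

lemma symmetric_sum_split:
  "symmetric_sum (\<lambda>u. 1 / (u + x) ^ k) J
    = (\<Sum>m<Suc J. 1 / (real m + x) ^ k) + (- 1) ^ k * (\<Sum>m<J. 1 / (real m + (1 - x)) ^ k)"
proof (induction J)
  case (Suc J)
  have "- real (Suc J) + x = (- 1) * (real J + (1 - x))"
    by simp
  then have "(- real (Suc J) + x) ^ k = (- 1) ^ k * (real J + (1 - x)) ^ k"
    by (simp only: power_mult_distrib)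
  then have "1 / (- real (Suc J) + x) ^ k = (- 1) ^ k * (1 / (real J + (1 - x)) ^ k)"
    by (cases "even k") simp_all
  then show ?case
    using Suc unfolding symmetric_sum_Suc sum.lessThan_Suc[of _ "Suc J"] sum.lessThan_Suc[of _ J]
    by (simp only: distrib_left add_ac)
qed simp

text \<open>Logarithmic differentiation of the reflection formula for the Gamma function.\<close>

lemma Digamma_reflection:
  fixes x :: real
  assumes x: "0 < x" "x < 1"
  shows "Digamma (1 - x) - Digamma x = pi * cot (pi * x)"
proof -
  have refl: "rGamma z * rGamma (1 - z) = sin (pi * z) / pi" for z :: real
  proof -
    have "complex_of_real (rGamma z * rGamma (1 - z)) = complex_of_real (sin (pi * z) / pi)"
      using rGamma_reflection_complex[of "complex_of_real z"]
        rGamma_complex_of_real[of z] rGamma_complex_of_real[of "1 - z"] sin_of_real[of "pi * z", where 'a = complex]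
      by simp
    then show ?thesis by (simp only: of_real_eq_iff)
  qed
  have nonpos: "x \<notin> \<int>\<^sub>\<le>\<^sub>0" "1 - x \<notin> \<int>\<^sub>\<le>\<^sub>0"
    using x by (auto elim!: nonpos_Ints_cases')
  have "((\<lambda>z. rGamma z * rGamma (1 - z)) has_field_derivative
      (- rGamma x * Digamma x) * rGamma (1 - x) + (- rGamma (1 - x) * Digamma (1 - x) * (0 - 1)) * rGamma x) (at x)"
    by (intro DERIV_mult DERIV_chain2[where f = rGamma and g = "\<lambda>z. 1 - z"] has_field_derivative_rGamma_no_nonpos_int nonpos derivative_intros)
  moreover have "((\<lambda>z. sin (pi * z) / pi) has_field_derivative cos (pi * x)) (at x)"
    by (auto intro!: derivative_eq_intros)
  ultimately have "(- rGamma x * Digamma x) * rGamma (1 - x)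
      + (- rGamma (1 - x) * Digamma (1 - x) * (0 - 1)) * rGamma x = cos (pi * x)"
    unfolding refl by (rule DERIV_unique)
  then have "rGamma x * rGamma (1 - x) * (Digamma (1 - x) - Digamma x) = cos (pi * x)"
    by (simp add: algebra_simps)
  moreover have "sin (pi * x) > 0"
    using x by (intro sin_gt_zero) auto
  ultimately show ?thesis
    by (simp add: refl cot_def field_simps)
qed

text \<open>The two halves of the symmetric sum are the sums in the limit formula for the
  Digamma function at \<open>x\<close> and at \<open>1 - x\<close>; the logarithms cancel.\<close>

lemma has_principal_sum_cot:
  assumes x: "0 < x" "x < 1"
  shows "has_principal_sum 1 x (pi * cot (pi * x))"
proof -
  have "(\<lambda>m. 1 / (real m + x) + ((ln (real m) - (\<Sum>k<m. inverse ((1 - x) + real k)))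
       - (ln (real m) - (\<Sum>k<m. inverse (x + real k))))) \<longlonglongrightarrow> 0 + (Digamma (1 - x) - Digamma x)"
    using Digamma_LIMSEQ[of x] Digamma_LIMSEQ[of "1 - x"] x
    by (intro tendsto_add tendsto_diff) (use inverse_shifted_power_LIMSEQ_0[of 1 x] in auto)
  also have "(\<lambda>m. 1 / (real m + x) + ((ln (real m) - (\<Sum>k<m. inverse ((1 - x) + real k)))
       - (ln (real m) - (\<Sum>k<m. inverse (x + real k)))))
      = symmetric_sum (\<lambda>u. 1 / (u + x) ^ 1)"
    unfolding fun_eq_iff symmetric_sum_split by (simp add: add.commute inverse_eq_divide)
  finally show ?thesis
    unfolding has_principal_sum_def Digamma_reflection[OF x] by simp
qed

lemma summable_Lerch_Phi:
  assumes t: "t > 0" and k: "k \<ge> 2" and x: "\<bar>x\<bar> = 1"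
  shows "summable (\<lambda>m. x ^ m / (real m + t) ^ k)"
proof (rule summable_comparison_test'[of "\<lambda>m. inverse (real m ^ k)" 1])
  show "summable (\<lambda>m. inverse (real m ^ k))"
    using inverse_power_summable[of k] k by (simp add: power_inverse)
  fix m :: nat assume "m \<ge> 1"
  then have "real m ^ k \<le> (real m + t) ^ k" "real m ^ k > 0" "(real m + t) ^ k > 0"
    using t by (auto intro: power_mono)
  then show "norm (x ^ m / (real m + t) ^ k) \<le> inverse (real m ^ k)"
    using x \<open>t > 0\<close> by (simp add: power_abs inverse_eq_divide frac_le)
qed

lemma has_principal_sum_Theta1:
  assumes i: "0 < i" "i < n" and k: "k \<ge> 1"
  shows "has_principal_sum k (real i / real n) (Theta1 k i n)"
proof (cases "k = 1")
  case True
  then show ?thesis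
    using has_principal_sum_cot[of "real i / real n"] i by (simp add: Theta1_def)
next
  case False
  let ?x = "real i / real n"
  have x: "?x > 0" "1 - ?x > 0" using i by simp_all
  have compl: "real (n - i) / real n = 1 - ?x"
    using i by (simp add: of_nat_diff diff_divide_distrib)
  have lim: "(\<lambda>J. \<Sum>m<J. 1 / (real m + t) ^ k) \<longlonglongrightarrow> Lerch_Phi 1 k t" if "t > 0" for t
    using summable_LIMSEQ[OF summable_Lerch_Phi[of t k 1]] that k False
    by (simp add: Lerch_Phi_def)
  have "(\<lambda>J. (\<Sum>m<Suc J. 1 / (real m + ?x) ^ k) + (- 1) ^ k * (\<Sum>m<J. 1 / (real m + (1 - ?x)) ^ k))
      \<longlonglongrightarrow> Lerch_Phi 1 k ?x + (- 1) ^ k * Lerch_Phi 1 k (1 - ?x)"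
    by (intro tendsto_add tendsto_mult_left lim x LIMSEQ_Suc)
  then show ?thesis
    using False unfolding has_principal_sum_def symmetric_sum_split[abs_def] Theta1_def compl
    by (simp only: if_False)
qed

lemma Theta1_reflect:
  assumes "0 < i" "i < n" and "k \<ge> 1"
  shows "Theta1 k (n - i) n = (- 1) ^ k * Theta1 k i n"
proof -
  have "has_principal_sum k (- (real i / real n) + real 1) ((- 1) ^ k * Theta1 k i n)"
    by (intro has_principal_sum_shift has_principal_sum_uminus has_principal_sum_Theta1 assms)
  moreover have "- (real i / real n) + real 1 = real (n - i) / real n"
    using assms by (simp add: of_nat_diff diff_divide_distrib)
  ultimately have "has_principal_sum k (real (n - i) / real n) ((- 1) ^ k * Theta1 k i n)"
    by simp
  moreover have "has_principal_sum k (real (n - i) / real n) (Theta1 k (n - i) n)"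
    using assms by (intro has_principal_sum_Theta1) auto
  ultimately show ?thesis
    unfolding has_principal_sum_def by (rule LIMSEQ_unique[rotated])
qed

lemma has_principal_sum_rational:
  assumes n: "n \<ge> 1" and k: "k \<ge> 1"
  shows "has_principal_sum k (real d / real n)
    (if n dvd d then (1 + (- 1) ^ k) * Li k 1 else Theta1 k (d mod n) n)"
proof -
  have "real d = real (n * (d div n)) + real (d mod n)"
    by (simp only: mult_div_mod_eq flip: of_nat_add)
  then have d: "real d / real n = real (d mod n) / real n + real (d div n)"
    using n by (simp add: add_divide_distrib)
  have "has_principal_sum k (real (d mod n) / real n)
    (if n dvd d then (1 + (- 1) ^ k) * Li k 1 else Theta1 k (d mod n) n)"
  proof (cases "n dvd d")
    case True
    then show ?thesis using has_principal_sum_0[OF k] by simp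
  next
    case False
    then have "0 < d mod n" "d mod n < n" using n by (auto simp: dvd_eq_mod_eq_0)
    then show ?thesis using has_principal_sum_Theta1[OF _ _ k] False by simp
  qed
  then show ?thesis
    unfolding d by (rule has_principal_sum_shift[OF _ k])
qed

section \<open>The product of two inverse powers summed over the integers\<close>

lemma symmetric_sum_indicator_0: "symmetric_sum (\<lambda>x. if x = 0 then 1 else 0) J = 1"
  by (simp add: symmetric_sum_def)

lemma symmetric_sum_indicator_LIMSEQ:
  assumes y: "y > 0"
  shows "symmetric_sum (\<lambda>x. if x = y then 1 else 0) \<longlonglongrightarrow> (if y \<in> \<nat> then 1 else 0)"
proof -
  have val: "symmetric_sum (\<lambda>x. if x = y then 1 else 0) J = (\<Sum>j = 1..J. if real j = y then 1 else 0)" for J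
    using y by (auto simp: symmetric_sum_def intro!: sum.cong)
  show ?thesis
  proof (cases "y \<in> \<nat>")
    case True
    then obtain c where c: "y = real c" by (auto elim: Nats_cases)
    have "eventually (\<lambda>J. symmetric_sum (\<lambda>x. if x = y then 1 else 0) J = 1) sequentially"
      using eventually_ge_at_top[of c]
    proof eventually_elim
      case (elim J)
      then show ?case using y unfolding val by (simp add: c sum.delta)
    qed
    then show ?thesis using True by (simp add: tendsto_eventually)
  next
    case False
    then have "real j \<noteq> y" for j by auto
    then show ?thesis using False by (simp add: val[abs_def])
  qed
qed

lemma symmetric_sum_product_LIMSEQ:
  fixes y :: real
  assumes y: "y > 0" and r: "r \<ge> 1" and s: "s \<ge> 1"
    and P: "\<And>k. k \<in> {1..r} \<Longrightarrow> has_principal_sum k y (P k)"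
  shows "symmetric_sum (\<lambda>x. 1 / (x ^ s * (x - y) ^ r)) \<longlonglongrightarrow>
      (- 1) ^ r * (\<Sum>k = 1..s. real ((s + r - k - 1) choose (r - 1)) / y ^ (s + r - k)
        * ((1 + (- 1) ^ k) * Li k 1))
    + (- 1) ^ r * (\<Sum>k = 1..r. real ((s + r - k - 1) choose (s - 1)) / y ^ (s + r - k) * P k)
    - (- 1) ^ r * real ((s + r - 1) choose s) / y ^ (s + r) * 1
    - (- 1) ^ r * real ((s + r - 1) choose r) / y ^ (s + r) * (if y \<in> \<nat> then 1 else 0)"
proof -
  have 1: "symmetric_sum (\<lambda>x. 1 / x ^ k) \<longlonglongrightarrow> (1 + (- 1) ^ k) * Li k 1" if "k \<in> {1..s}" for k
    using has_principal_sum_0[of k] that by (simp add: has_principal_sum_def)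
  have 2: "symmetric_sum (\<lambda>x. (- 1) ^ k / (x - y) ^ k) \<longlonglongrightarrow> P k" if "k \<in> {1..r}" for k
  proof -
    have "symmetric_sum (\<lambda>x. (- 1) ^ k * (1 / (x + - y) ^ k)) \<longlonglongrightarrow> (- 1) ^ k * ((- 1) ^ k * P k)"
      unfolding symmetric_sum_cmult[abs_def]
      using has_principal_sum_uminus[OF P[OF that]] unfolding has_principal_sum_def by (rule tendsto_mult_left)
    then show ?thesis by (simp flip: mult.assoc power_mult_distrib)
  qed
  have "symmetric_sum (\<lambda>x. 1 / (x ^ s * (x - y) ^ r)) J =
      (- 1) ^ r * (\<Sum>k = 1..s. real ((s + r - k - 1) choose (r - 1)) / y ^ (s + r - k)
        * symmetric_sum (\<lambda>x. 1 / x ^ k) J)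
    + (- 1) ^ r * (\<Sum>k = 1..r. real ((s + r - k - 1) choose (s - 1)) / y ^ (s + r - k)
        * symmetric_sum (\<lambda>x. (- 1) ^ k / (x - y) ^ k) J)
    - (- 1) ^ r * real ((s + r - 1) choose s) / y ^ (s + r) * 1
    - (- 1) ^ r * real ((s + r - 1) choose r) / y ^ (s + r) * symmetric_sum (\<lambda>x. if x = y then 1 else 0) J"
    for J
  proof -
    have "y \<noteq> 0" using y by simp
    show ?thesis
      by (subst partial_fractions_total[OF \<open>y \<noteq> 0\<close> r s])
         (simp only: symmetric_sum_diff symmetric_sum_add symmetric_sum_cmult symmetric_sum_sum
            symmetric_sum_indicator_0)
  qed
  then have eq: "symmetric_sum (\<lambda>x. 1 / (x ^ s * (x - y) ^ r)) = (\<lambda>J.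
      (- 1) ^ r * (\<Sum>k = 1..s. real ((s + r - k - 1) choose (r - 1)) / y ^ (s + r - k)
        * symmetric_sum (\<lambda>x. 1 / x ^ k) J)
    + (- 1) ^ r * (\<Sum>k = 1..r. real ((s + r - k - 1) choose (s - 1)) / y ^ (s + r - k)
        * symmetric_sum (\<lambda>x. (- 1) ^ k / (x - y) ^ k) J)
    - (- 1) ^ r * real ((s + r - 1) choose s) / y ^ (s + r) * 1
    - (- 1) ^ r * real ((s + r - 1) choose r) / y ^ (s + r) * symmetric_sum (\<lambda>x. if x = y then 1 else 0) J)"
    by (rule ext)
  show ?thesis
    unfolding eq
    by (intro tendsto_diff tendsto_add tendsto_mult_left tendsto_sum tendsto_const
        symmetric_sum_indicator_LIMSEQ[OF y] 1 2) simp_all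
qed

text \<open>Half of what an integral pole of the product of two inverse powers contributes, through its
  partial fractions, to the sum over the integers, up to the sign \<open>(- 1) ^ r\<close>.  Here \<open>1 / z\<close> is
  the distance of the two poles; odd exponents have cancelled.\<close>

definition even_zeta_sum :: "nat \<Rightarrow> nat \<Rightarrow> real \<Rightarrow> real" where
  "even_zeta_sum s r z = (\<Sum>i = 0..s div 2.
     real ((s + r - 2 * i - 1) choose (r - 1)) * Li (2 * i) 1 * z ^ (s + r - 2 * i))"

lemma sum_even_indices:
  fixes G :: "nat \<Rightarrow> real"
  shows "(\<Sum>k = 1..s. (1 + (- 1) ^ k) * G k) + 2 * G 0 = 2 * (\<Sum>i = 0..s div 2. G (2 * i))"
proof (induction s)
  case (Suc s)
  show ?case
  proof (cases "even s")
    case True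
    then show ?thesis using Suc by simp
  next
    case False
    then obtain t where "s = 2 * t + 1" by (elim oddE)
    then show ?thesis using Suc by simp
  qed
qed simp

text \<open>The correction for the omitted pole has the form of a term of index 0 in the sum over even
  zeta values, which is where \<open>\<zeta>(0) = - 1 / 2\<close> enters.\<close>

lemma even_zeta_sum_eq:
  fixes y :: real
  assumes r: "r \<ge> 1"
  shows "(\<Sum>k = 1..s. real ((s + r - k - 1) choose (r - 1)) / y ^ (s + r - k) * ((1 + (- 1) ^ k) * Li k 1))
      - real ((s + r - 1) choose s) / y ^ (s + r) = 2 * even_zeta_sum s r (1 / y)"
proof -
  define G where "G k = real ((s + r - k - 1) choose (r - 1)) * Li k 1 * (1 / y) ^ (s + r - k)" for k
  have "s + r - 1 - s = r - 1" by simp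
  then have "(s + r - 1) choose s = (s + r - 1) choose (r - 1)"
    using binomial_symmetric[of s "s + r - 1"] r by simp
  then have "real ((s + r - 1) choose s) / y ^ (s + r) = - 2 * G 0"
    by (simp add: G_def Li_def power_one_over)
  moreover have "(\<Sum>k = 1..s. real ((s + r - k - 1) choose (r - 1)) / y ^ (s + r - k) * ((1 + (- 1) ^ k) * Li k 1))
      = (\<Sum>k = 1..s. (1 + (- 1) ^ k) * G k)"
    by (intro sum.cong refl) (simp add: G_def power_one_over)
  ultimately show ?thesis
    using sum_even_indices[of G s] by (simp add: even_zeta_sum_def G_def)
qed

text \<open>The closed form of \<open>\<Sum>j\<in>\<int>. 1 / (j ^ s * (j - d / n) ^ r)\<close> without the poles.\<close>

definition lattice_sum :: "nat \<Rightarrow> nat \<Rightarrow> nat \<Rightarrow> nat \<Rightarrow> real" where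
  "lattice_sum n s r d = (- 1) ^ r *
     (2 * even_zeta_sum s r (real n / real d)
      + (if n dvd d then 2 * even_zeta_sum r s (real n / real d)
         else (\<Sum>k = 1..r. real ((s + r - k - 1) choose (s - 1)) * (real n / real d) ^ (s + r - k)
                * Theta1 k (d mod n) n)))"

lemma symmetric_sum_lattice_LIMSEQ:
  assumes n: "n \<ge> 1" and d: "d \<ge> 1" and r: "r \<ge> 1" and s: "s \<ge> 1"
  shows "symmetric_sum (\<lambda>x. 1 / (x ^ s * (x - real d / real n) ^ r)) \<longlonglongrightarrow> lattice_sum n s r d"
proof -
  define y where "y = real d / real n"
  define P where "P k = (if n dvd d then (1 + (- 1) ^ k) * Li k 1 else Theta1 k (d mod n) n)" for k
  have y: "y > 0" using n d by (simp add: y_def)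
  have inv_y: "real n / real d = 1 / y" by (simp add: y_def)
  have Nats: "y \<in> \<nat> \<longleftrightarrow> n dvd d"
  proof
    assume "y \<in> \<nat>"
    then obtain c where "y = real c" by (auto elim: Nats_cases)
    then have "real d = real (n * c)" using n by (simp add: y_def field_simps)
    then show "n dvd d" by (simp only: of_nat_eq_iff dvd_triv_left)
  next
    assume "n dvd d"
    then obtain c where "d = n * c" ..
    then show "y \<in> \<nat>" using n by (simp add: y_def)
  qed
  have "symmetric_sum (\<lambda>x. 1 / (x ^ s * (x - y) ^ r)) \<longlonglongrightarrow>
      (- 1) ^ r * (\<Sum>k = 1..s. real ((s + r - k - 1) choose (r - 1)) / y ^ (s + r - k)
        * ((1 + (- 1) ^ k) * Li k 1))
    + (- 1) ^ r * (\<Sum>k = 1..r. real ((s + r - k - 1) choose (s - 1)) / y ^ (s + r - k) * P k)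
    - (- 1) ^ r * real ((s + r - 1) choose s) / y ^ (s + r) * 1
    - (- 1) ^ r * real ((s + r - 1) choose r) / y ^ (s + r) * (if y \<in> \<nat> then 1 else 0)"
  proof (rule symmetric_sum_product_LIMSEQ[OF y r s])
    fix k assume "k \<in> {1..r}"
    then show "has_principal_sum k y (P k)"
      unfolding P_def y_def using n by (intro has_principal_sum_rational) auto
  qed
  also have "(- 1) ^ r * (\<Sum>k = 1..s. real ((s + r - k - 1) choose (r - 1)) / y ^ (s + r - k)
        * ((1 + (- 1) ^ k) * Li k 1))
    + (- 1) ^ r * (\<Sum>k = 1..r. real ((s + r - k - 1) choose (s - 1)) / y ^ (s + r - k) * P k)
    - (- 1) ^ r * real ((s + r - 1) choose s) / y ^ (s + r) * 1
    - (- 1) ^ r * real ((s + r - 1) choose r) / y ^ (s + r) * (if y \<in> \<nat> then 1 else 0)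
    = (- 1) ^ r * (((\<Sum>k = 1..s. real ((s + r - k - 1) choose (r - 1)) / y ^ (s + r - k)
          * ((1 + (- 1) ^ k) * Li k 1)) - real ((s + r - 1) choose s) / y ^ (s + r))
      + ((\<Sum>k = 1..r. real ((s + r - k - 1) choose (s - 1)) / y ^ (s + r - k) * P k)
          - real ((s + r - 1) choose r) / y ^ (s + r) * (if n dvd d then 1 else 0)))"
    unfolding Nats by (simp add: ring_distribs)
  also have "\<dots> = lattice_sum n s r d"
  proof -
    have "(\<Sum>k = 1..r. real ((s + r - k - 1) choose (s - 1)) / y ^ (s + r - k) * P k)
          - real ((s + r - 1) choose r) / y ^ (s + r) * (if n dvd d then 1 else 0)
        = (if n dvd d then 2 * even_zeta_sum r s (1 / y)
         else (\<Sum>k = 1..r. real ((s + r - k - 1) choose (s - 1)) * (1 / y) ^ (s + r - k)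
                * Theta1 k (d mod n) n))"
      using even_zeta_sum_eq[OF s, of r y]
      by (auto simp: P_def add.commute power_one_over)
    then show ?thesis
      unfolding lattice_sum_def inv_y even_zeta_sum_eq[OF r] by simp
  qed
  finally show ?thesis by (simp add: y_def)
qed

section \<open>Summation by rows\<close>

lemma Li_trunc_dist:
  fixes a :: real
  assumes a: "a \<in> {1, - 1}" and m: "m \<ge> 1" and le: "K \<le> K'" "K' \<le> K + N"
  shows "\<bar>Li_trunc m a K' - Li_trunc m a K\<bar> \<le> 2 * sqrt (real N)"
proof -
  have "\<bar>Li_trunc m a (K + (K' - K)) - Li_trunc m a K\<bar> \<le> 2 * sqrt (real (K' - K))"
    by (rule Li_trunc_diff_bound[OF a m])
  also have "\<dots> \<le> 2 * sqrt (real N)" using le by simp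
  finally show ?thesis using le by simp
qed

text \<open>The substitution \<open>m = \<bar>N - d\<bar>\<close> turns \<open>a ^ d\<close> into \<open>a ^ N * a ^ m\<close>.  Truncated subtraction
  makes one formula cover all relative positions of \<open>D\<close> and \<open>N\<close>, since \<open>Li_trunc r a 0 = 0\<close>.\<close>

lemma sum_window_left:
  fixes a :: real
  assumes a: "a \<in> {1, - 1}" and N: "N \<ge> 1" and r: "r \<ge> 1"
  shows "(\<Sum>d = 1..D. a ^ d / (real N - real d) ^ r)
    = a ^ N * (Li_trunc r a (N - 1) - Li_trunc r a (N - 1 - D) + (- 1) ^ r * Li_trunc r a (D - N))"
proof (induction D)
  case (Suc D)
  consider "Suc D < N" | "Suc D = N" | "Suc D > N" by linarith
  then show ?case
  proof cases
    case 1
    define e where "e = N - Suc D"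
    have e: "N - 1 - D = Suc (e - 1)" "N - 1 - Suc D = e - 1" "real N - real (Suc D) = real e" "N = e + Suc D" "Suc (e - 1) = e"
      using 1 by (auto simp: e_def)
    have "a ^ N * a ^ e = (a ^ e * a ^ e) * a ^ Suc D"
      unfolding e(4) power_add by (simp only: mult_ac)
    then have "a ^ N * a ^ e = a ^ Suc D"
      using sign_powers(2)[OF a, of e] by simp
    then have "a ^ Suc D / (real N - real (Suc D)) ^ r = a ^ N * (a ^ e / real e ^ r)"
      unfolding e(3) times_divide_eq_right by (simp only:)
    moreover have "Li_trunc r a (N - 1 - D) = Li_trunc r a (e - 1) + a ^ e / real e ^ r"
      using Li_trunc_Suc[of r a "e - 1"] by (simp only: e(1,5))
    moreover have "(\<Sum>d = 1..Suc D. a ^ d / (real N - real d) ^ r)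
        = (\<Sum>d = 1..D. a ^ d / (real N - real d) ^ r) + a ^ Suc D / (real N - real (Suc D)) ^ r"
      by simp
    moreover have "Li_trunc r a (D - N) = 0" "Li_trunc r a (Suc D - N) = 0"
      using 1 by simp_all
    ultimately show ?thesis
      unfolding e(2) Suc by (simp only: ring_distribs)
  next
    case 2
    have "a ^ Suc D / (real N - real (Suc D)) ^ r = 0" "Li_trunc r a (N - 1 - D) = 0"
        "Li_trunc r a (N - 1 - Suc D) = 0" "Li_trunc r a (D - N) = 0" "Li_trunc r a (Suc D - N) = 0"
      using r by (simp_all add: zero_power flip: 2)
    moreover have "(\<Sum>d = 1..Suc D. a ^ d / (real N - real d) ^ r)
        = (\<Sum>d = 1..D. a ^ d / (real N - real d) ^ r) + a ^ Suc D / (real N - real (Suc D)) ^ r"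
      by simp
    ultimately show ?thesis using Suc by (simp only:)
  next
    case 3
    define e where "e = Suc D - N"
    have e: "Suc D - N = Suc (e - 1)" "D - N = e - 1" "real N - real (Suc D) = - real e" "Suc D = e + N" "Suc (e - 1) = e"
      using 3 by (auto simp: e_def)
    have "a ^ Suc D / (real N - real (Suc D)) ^ r = a ^ N * ((- 1) ^ r * (a ^ e / real e ^ r))"
      unfolding e(3) e(4) power_add power_minus[of "real e"] by (cases "even r") (simp_all add: mult.commute)
    moreover have "Li_trunc r a (Suc D - N) = Li_trunc r a (e - 1) + a ^ e / real e ^ r"
      using Li_trunc_Suc[of r a "e - 1"] by (simp only: e(1,5))
    moreover have "(\<Sum>d = 1..Suc D. a ^ d / (real N - real d) ^ r)
        = (\<Sum>d = 1..D. a ^ d / (real N - real d) ^ r) + a ^ Suc D / (real N - real (Suc D)) ^ r"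
      by simp
    moreover have "Li_trunc r a (N - 1 - D) = 0" "Li_trunc r a (N - 1 - Suc D) = 0"
      using 3 by simp_all
    ultimately show ?thesis
      unfolding e(2) Suc by (simp only: ring_distribs)
  qed
qed simp

lemma sum_window_right:
  fixes a :: real
  assumes a: "a \<in> {1, - 1}"
  shows "(\<Sum>d = 1..D. a ^ d / (real N + real d) ^ r) = a ^ N * (Li_trunc r a (N + D) - Li_trunc r a N)"
proof (induction D)
  case (Suc D)
  have "a ^ N * a ^ Suc (N + D) = (a ^ N * a ^ N) * a ^ Suc D"
    by (simp add: power_add)
  then have "a ^ N * a ^ Suc (N + D) = a ^ Suc D"
    using sign_powers(2)[OF a, of N] by simp
  then have "a ^ Suc D / (real N + real (Suc D)) ^ r = a ^ N * (a ^ Suc (N + D) / real (Suc (N + D)) ^ r)"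
    by (simp only: times_divide_eq_right add_Suc_right flip: of_nat_add)
  then show ?case using Suc by (simp add: algebra_simps del: power_Suc)
qed simp

text \<open>Up to the factor \<open>a ^ N\<close>, this is
  \<open>\<Sum>d\<le>D. a ^ d * (1 / (N - d) ^ r - 1 / (N + d) ^ r)\<close> plus the regularising term
  \<open>(1 - (- 1) ^ r) * a ^ N * Li_trunc r a D\<close>, which is distributed over the two differences so
  that each of them tends to 0 in \<open>D\<close>.\<close>

definition row_sum :: "real \<Rightarrow> nat \<Rightarrow> nat \<Rightarrow> nat \<Rightarrow> real" where
  "row_sum a r N D = Li_trunc r a (N - 1) - Li_trunc r a (N - 1 - D)
     + (- 1) ^ r * (Li_trunc r a (D - N) - Li_trunc r a D)
     - (Li_trunc r a (N + D) - Li_trunc r a D) + Li_trunc r a N"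

lemma row_sum_LIMSEQ:
  fixes a :: real
  assumes a: "a \<in> {1, - 1}" and r: "r \<ge> 1"
  shows "row_sum a r N \<longlonglongrightarrow> Li_trunc r a (N - 1) + Li_trunc r a N"
proof -
  have 1: "(\<lambda>D. Li_trunc r a (N + D) - Li_trunc r a D) \<longlonglongrightarrow> 0"
    using Li_trunc_shift_LIMSEQ[OF a r, of N] by (simp add: add.commute)
  have "(\<lambda>D. Li_trunc r a (D + N - N) - Li_trunc r a (D + N)) \<longlonglongrightarrow> 0"
    using tendsto_minus[OF Li_trunc_shift_LIMSEQ[OF a r, of N]] by simp
  then have 2: "(\<lambda>D. Li_trunc r a (D - N) - Li_trunc r a D) \<longlonglongrightarrow> 0"
    by (rule LIMSEQ_offset)
  have 3: "(\<lambda>D. Li_trunc r a (N - 1 - D)) \<longlonglongrightarrow> 0"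
    by (rule tendsto_eventually) (use eventually_ge_at_top[of N] in eventually_elim, simp)
  have "row_sum a r N \<longlonglongrightarrow> Li_trunc r a (N - 1) - 0 + (- 1) ^ r * 0 - 0 + Li_trunc r a N"
    unfolding row_sum_def[abs_def] by (intro tendsto_intros 1 2 3)
  then show ?thesis by simp
qed

lemma row_sum_bound:
  fixes a :: real
  assumes a: "a \<in> {1, - 1}" and r: "r \<ge> 1"
  shows "\<bar>row_sum a r N D\<bar> \<le> 8 * sqrt (real N)"
proof -
  have "\<bar>Li_trunc r a (N - 1) - Li_trunc r a (N - 1 - D)\<bar> \<le> 2 * sqrt (real N)"
    by (rule Li_trunc_dist[OF a r]) auto
  moreover have "\<bar>Li_trunc r a D - Li_trunc r a (D - N)\<bar> \<le> 2 * sqrt (real N)"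
    by (rule Li_trunc_dist[OF a r]) auto
  moreover have "\<bar>(- 1) ^ r * (Li_trunc r a (D - N) - Li_trunc r a D)\<bar>
      = \<bar>Li_trunc r a D - Li_trunc r a (D - N)\<bar>"
    by (simp add: abs_mult power_abs abs_minus_commute)
  moreover have "\<bar>Li_trunc r a (N + D) - Li_trunc r a D\<bar> \<le> 2 * sqrt (real N)"
    by (rule Li_trunc_dist[OF a r]) auto
  moreover have "\<bar>Li_trunc r a N\<bar> \<le> 2 * sqrt (real N)"
    by (rule Li_trunc_bound[OF a r])
  moreover have "\<bar>x + y - z + w\<bar> \<le> 8 * t"
    if "\<bar>x\<bar> \<le> 2 * t" "\<bar>y'\<bar> \<le> 2 * t" "\<bar>y\<bar> = \<bar>y'\<bar>" "\<bar>z\<bar> \<le> 2 * t" "\<bar>w\<bar> \<le> 2 * t"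
    for x y y' z w t :: real
    using that by linarith
  ultimately show ?thesis unfolding row_sum_def by blast
qed

text \<open>The indices \<open>j\<close> and \<open>- j\<close> are combined; the minus sign is \<open>(- 1) ^ (s + r)\<close>, and here the
  parity of the weight enters.\<close>

lemma lattice_sum_sums:
  assumes n: "n \<ge> 1" and d: "d \<ge> 1" and r: "r \<ge> 1" and s: "s \<ge> 1" and odd: "odd (s + r)"
  shows "(\<lambda>j. real n ^ r / real (Suc j) ^ s * (1 / (real (n * Suc j) - real d) ^ r
      - 1 / (real (n * Suc j) + real d) ^ r)) sums lattice_sum n s r d"
proof -
  define f where "f x = 1 / (x ^ s * (x - real d / real n) ^ r)" for x
  have "symmetric_sum f = (\<lambda>J. \<Sum>j = 1..J. f (real j) + f (- real j))"
    using s by (simp add: symmetric_sum_def[abs_def] f_def zero_power)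
  then have "(\<lambda>J. \<Sum>j = 1..J. f (real j) + f (- real j)) \<longlonglongrightarrow> lattice_sum n s r d"
    using symmetric_sum_lattice_LIMSEQ[OF n d r s] by (simp add: f_def[abs_def])
  then have "(\<lambda>j. f (real (Suc j)) + f (- real (Suc j))) sums lattice_sum n s r d"
    by (simp only: sums_Suc_iff_LIMSEQ[of "\<lambda>j. f (real j) + f (- real j)"])
  moreover have "f (real j) + f (- real j) = real n ^ r / real j ^ s * (1 / (real (n * j) - real d) ^ r
      - 1 / (real (n * j) + real d) ^ r)" for j
  proof -
    have "f (real j) = real n ^ r / real j ^ s * (1 / (real (n * j) - real d) ^ r)"
    proof -
      have "real j - real d / real n = (real (n * j) - real d) / real n"
        using n by (simp add: field_simps)
      then show ?thesis by (simp add: f_def power_divide)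
    qed
    moreover have "f (- real j) = - (real n ^ r / real j ^ s * (1 / (real (n * j) + real d) ^ r))"
    proof -
      have "- real j - real d / real n = - ((real (n * j) + real d) / real n)"
        using n by (simp add: field_simps)
      then have "(- real j) ^ s * (- real j - real d / real n) ^ r
          = (- 1) ^ (s + r) * (real j ^ s * ((real (n * j) + real d) ^ r / real n ^ r))"
        by (simp add: power_minus[of "real j"] power_minus[of "_ / _"] power_add power_divide)
      then show ?thesis using odd by (simp add: f_def)
    qed
    ultimately show ?thesis by (simp add: ring_distribs)
  qed
  ultimately show ?thesis by (simp only:)
qed

lemma summable_euler_term:
  fixes a :: real
  assumes a: "a \<in> {1, - 1}" and r: "r \<ge> 1" and s: "s \<ge> 2"
  shows "summable (\<lambda>j. a ^ (n * Suc j) * Li_trunc r a (n * Suc j) / real (Suc j) ^ s)"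
proof (rule summable_comparison_test')
  show "summable (\<lambda>j. 2 * sqrt (real n) * (sqrt (real (Suc j)) / real (Suc j) ^ s))"
    by (intro summable_mult summable_sqrt_over_power s)
  fix j :: nat
  have "\<bar>Li_trunc r a (n * Suc j)\<bar> \<le> 2 * (sqrt (real n) * sqrt (real (Suc j)))"
    using Li_trunc_bound[OF a r, of "n * Suc j"] by (simp only: of_nat_mult real_sqrt_mult)
  moreover have "\<bar>a ^ (n * Suc j)\<bar> = 1" by (rule sign_powers(1)[OF a])
  ultimately show "norm (a ^ (n * Suc j) * Li_trunc r a (n * Suc j) / real (Suc j) ^ s)
      \<le> 2 * sqrt (real n) * (sqrt (real (Suc j)) / real (Suc j) ^ s)"
    by (simp add: abs_mult divide_right_mono)
qed

text \<open>In the limit the row at \<open>N\<close> has \<open>h(N - 1) + h(N) = 2 * h(N) - a ^ N / N ^ r\<close> with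
  \<open>h = Li_trunc r a\<close>, and the last term sums to the zeta value of the weight.\<close>

lemma lattice_sums_LIMSEQ_by_rows:
  fixes a :: real
  assumes a: "a \<in> {1, - 1}" and n: "n \<ge> 1" and r: "r \<ge> 1" and s: "s \<ge> 2" and odd: "odd (s + r)"
  shows "(\<lambda>D. (\<Sum>d = 1..D. a ^ d * lattice_sum n s r d)
            + (1 - (- 1) ^ r) * real n ^ r * Li s (a ^ n) * Li_trunc r a D)
      \<longlonglongrightarrow> 2 * real n ^ r * (\<Sum>j. a ^ (n * Suc j) * Li_trunc r a (n * Suc j) / real (Suc j) ^ s)
          - Li (s + r) 1"
proof -
  define A where "A j D = real n ^ r / real (Suc j) ^ s * (a ^ (n * Suc j) * row_sum a r (n * Suc j) D)" for j D
  define B where "B j = real n ^ r / real (Suc j) ^ s * (a ^ (n * Suc j)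
     * (Li_trunc r a (n * Suc j - 1) + Li_trunc r a (n * Suc j)))" for j
  have A_sums: "(\<lambda>j. A j D) sums ((\<Sum>d = 1..D. a ^ d * lattice_sum n s r d)
            + (1 - (- 1) ^ r) * real n ^ r * Li s (a ^ n) * Li_trunc r a D)" for D
  proof -
    have 1: "(\<lambda>j. \<Sum>d = 1..D. a ^ d * (real n ^ r / real (Suc j) ^ s * (1 / (real (n * Suc j) - real d) ^ r
      - 1 / (real (n * Suc j) + real d) ^ r))) sums (\<Sum>d = 1..D. a ^ d * lattice_sum n s r d)"
      by (intro sums_sum sums_mult lattice_sum_sums n r odd) (use s in auto)
    have "(\<lambda>j. (a ^ n) ^ Suc j / real (Suc j) ^ s) sums Li s (a ^ n)"
      using s by (intro Li_sums sign_powers[OF a]) auto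
    then have 2: "(\<lambda>j. (1 - (- 1) ^ r) * real n ^ r * Li_trunc r a D * ((a ^ n) ^ Suc j / real (Suc j) ^ s))
        sums ((1 - (- 1) ^ r) * real n ^ r * Li_trunc r a D * Li s (a ^ n))"
      by (rule sums_mult)
    have "A j D = (\<Sum>d = 1..D. a ^ d * (real n ^ r / real (Suc j) ^ s * (1 / (real (n * Suc j) - real d) ^ r
      - 1 / (real (n * Suc j) + real d) ^ r)))
      + (1 - (- 1) ^ r) * real n ^ r * Li_trunc r a D * ((a ^ n) ^ Suc j / real (Suc j) ^ s)" for j
    proof -
      define N where "N = n * Suc j"
      have N: "N \<ge> 1" using n by (simp add: N_def)
      define c where "c = real n ^ r / real (Suc j) ^ s"
      have "(\<Sum>d = 1..D. a ^ d * (c * (1 / (real N - real d) ^ r - 1 / (real N + real d) ^ r)))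
          = c * ((\<Sum>d = 1..D. a ^ d / (real N - real d) ^ r) - (\<Sum>d = 1..D. a ^ d / (real N + real d) ^ r))"
        by (simp add: sum_distrib_left algebra_simps flip: sum_subtractf)
      also have "\<dots> = c * (a ^ N * (Li_trunc r a (N - 1) - Li_trunc r a (N - 1 - D)
          + (- 1) ^ r * Li_trunc r a (D - N) - (Li_trunc r a (N + D) - Li_trunc r a N)))"
        unfolding sum_window_left[OF a N r] sum_window_right[OF a] by (simp add: algebra_simps)
      finally have *: "(\<Sum>d = 1..D. a ^ d * (c * (1 / (real N - real d) ^ r - 1 / (real N + real d) ^ r)))
          = c * (a ^ N * (Li_trunc r a (N - 1) - Li_trunc r a (N - 1 - D)
          + (- 1) ^ r * Li_trunc r a (D - N) - (Li_trunc r a (N + D) - Li_trunc r a N)))" .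
      have "(1 - (- 1) ^ r) * real n ^ r * Li_trunc r a D * ((a ^ n) ^ Suc j / real (Suc j) ^ s)
          = c * (a ^ N * ((1 - (- 1) ^ r) * Li_trunc r a D))"
        by (simp only: c_def N_def power_mult) simp
      then show ?thesis
        unfolding A_def row_sum_def N_def[symmetric] c_def[symmetric] * by (simp add: algebra_simps)
    qed
    then show ?thesis
      using sums_add[OF 1 2] by (simp only: mult_ac)
  qed
  have A_lim: "A j \<longlonglongrightarrow> B j" for j
    unfolding A_def B_def by (intro tendsto_intros row_sum_LIMSEQ a r)
  define M where "M j = real n ^ r * 8 * sqrt (real n) * (sqrt (real (Suc j)) / real (Suc j) ^ s)" for j
  have A_bound: "norm (A j D) \<le> M j" for j D
  proof -
    have "\<bar>row_sum a r (n * Suc j) D\<bar> \<le> 8 * (sqrt (real n) * sqrt (real (Suc j)))"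
      using row_sum_bound[OF a r, of "n * Suc j" D] by (simp only: of_nat_mult real_sqrt_mult)
    then have "real n ^ r / real (Suc j) ^ s * \<bar>row_sum a r (n * Suc j) D\<bar>
       \<le> real n ^ r / real (Suc j) ^ s * (8 * (sqrt (real n) * sqrt (real (Suc j))))"
      by (intro mult_left_mono) auto
    moreover have "\<bar>a ^ (n * Suc j)\<bar> = 1" by (rule sign_powers(1)[OF a])
    ultimately show ?thesis
      by (simp add: A_def M_def abs_mult algebra_simps)
  qed
  have "summable M"
    unfolding M_def by (intro summable_mult summable_sqrt_over_power s)
  moreover have "eventually (\<lambda>(j, D). norm (A j D) \<le> M j) (sequentially \<times>\<^sub>F sequentially)"
    by (rule always_eventually) (use A_bound in auto)
  ultimately have "(\<lambda>D. \<Sum>j. A j D) \<longlonglongrightarrow> (\<Sum>j. B j)"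
    by (intro tannerys_theorem[THEN conjunct2, THEN conjunct2, of A B sequentially M] A_lim) simp_all
  moreover have "(\<lambda>D. \<Sum>j. A j D) = (\<lambda>D. (\<Sum>d = 1..D. a ^ d * lattice_sum n s r d)
            + (1 - (- 1) ^ r) * real n ^ r * Li s (a ^ n) * Li_trunc r a D)"
    by (rule ext, rule sums_unique[symmetric], rule A_sums)
  moreover have "(\<Sum>j. B j) = 2 * real n ^ r * (\<Sum>j. a ^ (n * Suc j) * Li_trunc r a (n * Suc j) / real (Suc j) ^ s)
          - Li (s + r) 1"
  proof (rule sums_unique[symmetric])
    have "(\<lambda>j. 2 * real n ^ r * (a ^ (n * Suc j) * Li_trunc r a (n * Suc j) / real (Suc j) ^ s)
        - 1 / real (Suc j) ^ (s + r))
      sums (2 * real n ^ r * (\<Sum>j. a ^ (n * Suc j) * Li_trunc r a (n * Suc j) / real (Suc j) ^ s) - Li (s + r) 1)"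
      using s by (intro sums_diff sums_mult summable_sums summable_euler_term a r sums_inverse_power) auto
    moreover have "B j = 2 * real n ^ r * (a ^ (n * Suc j) * Li_trunc r a (n * Suc j) / real (Suc j) ^ s)
        - 1 / real (Suc j) ^ (s + r)" for j
    proof -
      define N where "N = n * Suc j"
      obtain N' where N': "N = Suc N'" using n by (cases N) (auto simp: N_def)
      have "a ^ N * Li_trunc r a (N - 1) = a ^ N * Li_trunc r a N - 1 / real N ^ r"
        using sign_powers(2)[OF a, of "Suc N'"] by (simp add: N' algebra_simps del: power_Suc)
      moreover have "real n ^ r / real (Suc j) ^ s * (1 / real N ^ r) = 1 / real (Suc j) ^ (s + r)"
        using n unfolding N_def of_nat_mult power_mult_distrib power_add by simp
      moreover have "B j = real n ^ r / real (Suc j) ^ s * (a ^ N * Li_trunc r a (N - 1) + a ^ N * Li_trunc r a N)"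
        unfolding B_def N_def[symmetric] by (simp only: distrib_left)
      ultimately have "B j = real n ^ r / real (Suc j) ^ s * (2 * (a ^ N * Li_trunc r a N)) - 1 / real (Suc j) ^ (s + r)"
        by (simp only: right_diff_distrib distrib_left diff_add_eq mult_2)
      then show ?thesis by (simp add: N_def)
    qed
    ultimately show "B sums (2 * real n ^ r * (\<Sum>j. a ^ (n * Suc j) * Li_trunc r a (n * Suc j) / real (Suc j) ^ s)
          - Li (s + r) 1)"
      by (simp add: fun_eq_iff[of B, THEN iffD2] cong: sums_cong)
  qed
  ultimately show ?thesis by simp
qed

section \<open>Summation by columns\<close>

lemma residue_class_sums:
  fixes f :: "nat \<Rightarrow> real"
  assumes c: "1 \<le> c" "c \<le> n" and f: "(\<lambda>m. f (n * m + c)) sums L"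
  shows "(\<lambda>D. \<Sum>d = 1..D. if d mod n = c mod n then f d else 0) \<longlonglongrightarrow> L"
proof -
  define g where "g d = (if Suc d mod n = c mod n then f (Suc d) else 0)" for d
  \<comment> \<open>\<open>g\<close> is indexed from 0, so the class of \<open>c\<close> sits at \<open>n * m + c - 1\<close>.\<close>
  define h where "h m = n * m + (c - 1)" for m
  have "strict_mono h"
  proof (rule strict_monoI)
    fix x y :: nat
    assume "x < y"
    then have "n * x < n * y" using c by simp
    then show "h x < h y" unfolding h_def by (rule add_strict_right_mono)
  qed
  moreover have "g d = 0" if "d \<notin> range h" for d
  proof (rule ccontr)
    assume "g d \<noteq> 0"
    then have eq: "Suc d mod n = c mod n" by (auto simp: g_def split: if_splits)
    have "c \<le> Suc d"
    proof (cases "c = n")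
      case True
      then have "n dvd Suc d" using eq by (simp add: dvd_eq_mod_eq_0)
      then show ?thesis using True by (auto dest: dvd_imp_le)
    next
      case False
      then have "c = Suc d mod n" using eq c by simp
      then show ?thesis by simp
    qed
    then have "n dvd Suc d - c" using eq by (simp add: mod_eq_dvd_iff_nat)
    then obtain m where "Suc d - c = n * m" ..
    then have "d = h m" using \<open>c \<le> Suc d\<close> c by (simp add: h_def)
    with that show False by blast
  qed
  ultimately have "(\<lambda>m. g (h m)) sums L \<longleftrightarrow> g sums L"
    by (rule sums_mono_reindex)
  moreover have "g (h m) = f (n * m + c)" for m
    using c by (simp add: g_def h_def)
  ultimately have "(\<lambda>d. if Suc d mod n = c mod n then f (Suc d) else 0) sums L"
    using f by (simp add: g_def[abs_def])
  then show ?thesis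
    by (simp only: sums_Suc_iff_LIMSEQ[of "\<lambda>d. if d mod n = c mod n then f d else 0"])
qed

lemma Li_multiples_LIMSEQ:
  fixes a :: real
  assumes a: "a \<in> {1, - 1}" and n: "n \<ge> 1" and m: "m \<ge> 2"
  shows "(\<lambda>D. \<Sum>d = 1..D. if n dvd d then a ^ d * (real n / real d) ^ m else 0) \<longlonglongrightarrow> Li m (a ^ n)"
proof -
  have "(\<lambda>j. (a ^ n) ^ Suc j / real (Suc j) ^ m) sums Li m (a ^ n)"
    using m by (intro Li_sums sign_powers[OF a]) auto
  moreover have "a ^ (n * j + n) * (real n / real (n * j + n)) ^ m = (a ^ n) ^ Suc j / real (Suc j) ^ m" for j
  proof -
    have "real n / real (n * j + n) = 1 / real (Suc j)"
    proof -
      have "real (n * j + n) = real n * real (Suc j)" by (simp add: algebra_simps)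
      then show ?thesis using n by simp
    qed
    then show ?thesis by (simp add: power_add power_mult power_one_over)
  qed
  ultimately have "(\<lambda>j. a ^ (n * j + n) * (real n / real (n * j + n)) ^ m) sums Li m (a ^ n)"
    by (simp only:)
  from residue_class_sums[where c = n, OF n order_refl this] show ?thesis
    by (simp add: dvd_eq_mod_eq_0)
qed

lemma Lerch_Phi_residue_class_LIMSEQ:
  fixes a :: real
  assumes a: "a \<in> {1, - 1}" and i: "1 \<le> i" "i < n" and m: "m \<ge> 2"
  shows "(\<lambda>D. \<Sum>d = 1..D. if d mod n = n - i then a ^ d * (real n / real d) ^ m else 0)
    \<longlonglongrightarrow> a ^ n * a ^ i * Lerch_Phi (a ^ n) m (real (n - i) / real n)"
proof -
  define t where "t = real (n - i) / real n"
  have t: "t > 0" using i by (simp add: t_def)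
  have ai: "a ^ (n - i) = a ^ n * a ^ i"
  proof -
    have "a ^ n * a ^ i = a ^ (n - i) * (a ^ i * a ^ i)"
      using i by (simp flip: power_add)
    then show ?thesis using sign_powers(2)[OF a, of i] by simp
  qed
  have "(\<lambda>j. a ^ n * a ^ i * ((a ^ n) ^ j / (real j + t) ^ m)) sums (a ^ n * a ^ i * Lerch_Phi (a ^ n) m t)"
    unfolding Lerch_Phi_def using sign_powers(1)[OF a] m t
    by (intro sums_mult summable_sums summable_Lerch_Phi) auto
  moreover have "a ^ (n * j + (n - i)) * (real n / real (n * j + (n - i))) ^ m
      = a ^ n * a ^ i * ((a ^ n) ^ j / (real j + t) ^ m)" for j
  proof -
    have "real (n * j + (n - i)) = real n * (real j + t)"
      using i by (simp add: t_def field_simps)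
    then have "real n / real (n * j + (n - i)) = 1 / (real j + t)"
      using i by simp
    then show ?thesis by (simp add: power_add power_mult power_one_over ai)
  qed
  ultimately have "(\<lambda>j. a ^ (n * j + (n - i)) * (real n / real (n * j + (n - i))) ^ m)
      sums (a ^ n * a ^ i * Lerch_Phi (a ^ n) m t)"
    by (simp only:)
  from residue_class_sums[where c = "n - i", OF _ _ this] show ?thesis
    using i by (simp add: t_def)
qed

lemma even_zeta_sum_trunc:
  "(\<Sum>d = 1..D. a ^ d * even_zeta_sum s r (real n / real d))
    = (\<Sum>i = 0..s div 2. real ((s + r - 2 * i - 1) choose (r - 1)) * Li (2 * i) 1
        * real n ^ (s + r - 2 * i) * Li_trunc (s + r - 2 * i) a D)"
  unfolding even_zeta_sum_def Li_trunc_def sum_distrib_left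
  by (subst sum.swap) (simp add: power_divide mult_ac)

text \<open>For \<open>a = 1\<close> and \<open>r = 1\<close> the divergent harmonic number occurs twice, with opposite coefficients:
  in the regularising term and in the last summand of the even zeta sum.  The convention
  \<open>Li 1 1 = 0\<close> records that cancellation.\<close>

lemma regularised_even_zeta_LIMSEQ:
  fixes a :: real
  assumes a: "a \<in> {1, - 1}" and r: "r \<ge> 1" and s: "s \<ge> 2" and odd: "odd (s + r)"
  shows "(\<lambda>D. (- 1) ^ r * (2 * (\<Sum>d = 1..D. a ^ d * even_zeta_sum s r (real n / real d)))
          + (1 - (- 1) ^ r) * real n ^ r * Li s (a ^ n) * Li_trunc r a D)
    \<longlonglongrightarrow> (- 1) ^ r * (2 * (\<Sum>i = 0..s div 2. real ((s + r - 2 * i - 1) choose (r - 1)) * Li (2 * i) 1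
        * real n ^ (s + r - 2 * i) * Li (s + r - 2 * i) a))
      + (1 - (- 1) ^ r) * real n ^ r * Li s (a ^ n) * Li r a"
proof -
  define G where "G i = real ((s + r - 2 * i - 1) choose (r - 1)) * Li (2 * i) 1 * real n ^ (s + r - 2 * i)" for i
  have eq: "(\<Sum>d = 1..D. a ^ d * even_zeta_sum s r (real n / real d))
      = (\<Sum>i = 0..s div 2. G i * Li_trunc (s + r - 2 * i) a D)" for D
    unfolding G_def by (rule even_zeta_sum_trunc)
  show ?thesis
    unfolding eq G_def[symmetric]
  proof (cases "r = 1 \<and> a = 1")
    case False
    have "s + r - 2 * i \<ge> 2 \<or> s + r - 2 * i = 1 \<and> a = - 1" if "i \<in> {0..s div 2}" for i
      using that a r False by auto
    moreover have "r \<ge> 2 \<or> r = 1 \<and> a = - 1"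
      using a r False by auto
    ultimately show "(\<lambda>D. (- 1) ^ r * (2 * (\<Sum>i = 0..s div 2. G i * Li_trunc (s + r - 2 * i) a D))
          + (1 - (- 1) ^ r) * real n ^ r * Li s (a ^ n) * Li_trunc r a D)
      \<longlonglongrightarrow> (- 1) ^ r * (2 * (\<Sum>i = 0..s div 2. G i * Li (s + r - 2 * i) a))
      + (1 - (- 1) ^ r) * real n ^ r * Li s (a ^ n) * Li r a"
      by (intro tendsto_add tendsto_mult_left tendsto_sum Li_trunc_LIMSEQ a)
  next
    case True
    then have r1: "r = 1" and a1: "a = 1" by auto
    obtain t where t: "s = 2 * t" using odd r1 by (auto elim: evenE)
    have G: "G t = Li s 1 * real n" by (simp add: G_def t r1)
    have split: "(\<Sum>i = 0..s div 2. F i) = (\<Sum>i<t. F i) + F t" for F :: "nat \<Rightarrow> real"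
      using t by (simp add: atLeast0AtMost flip: lessThan_Suc_atMost)
    have "s + r - 2 * i \<ge> 2" if "i \<in> {..<t}" for i
      using that t r1 by auto
    then have "(\<lambda>D. - (2 * (\<Sum>i<t. G i * Li_trunc (s + r - 2 * i) a D)))
      \<longlonglongrightarrow> - (2 * (\<Sum>i<t. G i * Li (s + r - 2 * i) a))"
      by (intro tendsto_minus tendsto_mult_left tendsto_sum Li_trunc_LIMSEQ a) auto
    moreover have "Li 1 1 = 0" by (simp add: Li_def)
    ultimately show "(\<lambda>D. (- 1) ^ r * (2 * (\<Sum>i = 0..s div 2. G i * Li_trunc (s + r - 2 * i) a D))
          + (1 - (- 1) ^ r) * real n ^ r * Li s (a ^ n) * Li_trunc r a D)
      \<longlonglongrightarrow> (- 1) ^ r * (2 * (\<Sum>i = 0..s div 2. G i * Li (s + r - 2 * i) a))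
      + (1 - (- 1) ^ r) * real n ^ r * Li s (a ^ n) * Li r a"
      unfolding split G r1 a1 by (simp add: t algebra_simps)
  qed
qed

lemma lattice_sums_LIMSEQ_by_columns:
  fixes a :: real
  assumes a: "a \<in> {1, - 1}" and n: "n \<ge> 1" and r: "r \<ge> 1" and s: "s \<ge> 2" and odd: "odd (s + r)"
  shows "(\<lambda>D. (\<Sum>d = 1..D. a ^ d * lattice_sum n s r d)
            + (1 - (- 1) ^ r) * real n ^ r * Li s (a ^ n) * Li_trunc r a D)
      \<longlonglongrightarrow> ((- 1) ^ r * (2 * (\<Sum>i = 0..s div 2. real ((s + r - 2 * i - 1) choose (r - 1)) * Li (2 * i) 1
            * real n ^ (s + r - 2 * i) * Li (s + r - 2 * i) a))
          + (1 - (- 1) ^ r) * real n ^ r * Li s (a ^ n) * Li r a)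
        + (- 1) ^ r * (2 * (\<Sum>i = 0..r div 2. real ((r + s - 2 * i - 1) choose (s - 1)) * Li (2 * i) 1
            * Li (r + s - 2 * i) (a ^ n)))
        + (- 1) ^ r * (\<Sum>i = 1..n - 1. \<Sum>k = 1..r. real ((s + r - k - 1) choose (s - 1)) * Theta1 k (n - i) n
            * (a ^ n * a ^ i * Lerch_Phi (a ^ n) (s + r - k) (real (n - i) / real n)))"
    (is "?F \<longlonglongrightarrow> ?L1 + (- 1) ^ r * (2 * ?L2) + (- 1) ^ r * ?L3")
proof -
  \<comment> \<open>\<open>U\<close> collects the columns with \<open>n dvd d\<close>, and \<open>V\<close> the others, sorted by \<open>n - d mod n\<close>.\<close>
  define U where "U d = (\<Sum>i = 0..r div 2. real ((r + s - 2 * i - 1) choose (s - 1)) * Li (2 * i) 1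
      * (if n dvd d then a ^ d * (real n / real d) ^ (r + s - 2 * i) else 0))" for d
  define V where "V d = (\<Sum>i = 1..n - 1. \<Sum>k = 1..r. real ((s + r - k - 1) choose (s - 1)) * Theta1 k (n - i) n
      * (if d mod n = n - i then a ^ d * (real n / real d) ^ (s + r - k) else 0))" for d
  have split: "a ^ d * lattice_sum n s r d = (- 1) ^ r * (2 * (a ^ d * even_zeta_sum s r (real n / real d)))
      + (- 1) ^ r * (2 * U d) + (- 1) ^ r * V d" for d
  proof (cases "n dvd d")
    case True
    have "V d = 0"
      unfolding V_def using True by (intro sum.neutral ballI) (auto simp: dvd_eq_mod_eq_0)
    moreover have "U d = a ^ d * even_zeta_sum r s (real n / real d)"
      unfolding U_def even_zeta_sum_def sum_distrib_left using True by (intro sum.cong) auto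
    ultimately show ?thesis using True by (simp add: lattice_sum_def algebra_simps)
  next
    case False
    have mod: "d mod n > 0" "d mod n < n" using False n by (auto simp: dvd_eq_mod_eq_0)
    have "V d = (\<Sum>i = 1..n - 1. if i = n - d mod n then
        (\<Sum>k = 1..r. real ((s + r - k - 1) choose (s - 1)) * Theta1 k (d mod n) n
         * (a ^ d * (real n / real d) ^ (s + r - k))) else 0)"
      unfolding V_def
    proof (intro sum.cong refl)
      fix i assume "i \<in> {1..n - 1}"
      then have "d mod n = n - i \<longleftrightarrow> i = n - d mod n" using mod by auto
      then show "(\<Sum>k = 1..r. real ((s + r - k - 1) choose (s - 1)) * Theta1 k (n - i) n
         * (if d mod n = n - i then a ^ d * (real n / real d) ^ (s + r - k) else 0))
        = (if i = n - d mod n then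
        (\<Sum>k = 1..r. real ((s + r - k - 1) choose (s - 1)) * Theta1 k (d mod n) n
         * (a ^ d * (real n / real d) ^ (s + r - k))) else 0)"
        by (cases "d mod n = n - i") auto
    qed
    also have "\<dots> = (\<Sum>k = 1..r. real ((s + r - k - 1) choose (s - 1)) * Theta1 k (d mod n) n
         * (a ^ d * (real n / real d) ^ (s + r - k)))"
    proof -
      have "n - d mod n \<in> {1..n - 1}" using mod by auto
      then show ?thesis by (subst sum.delta) auto
    qed
    also have "\<dots> = a ^ d * (\<Sum>k = 1..r. real ((s + r - k - 1) choose (s - 1)) * (real n / real d) ^ (s + r - k)
                * Theta1 k (d mod n) n)"
      unfolding sum_distrib_left by (intro sum.cong refl) (simp only: mult_ac)
    finally have "V d = a ^ d * (\<Sum>k = 1..r. real ((s + r - k - 1) choose (s - 1)) * (real n / real d) ^ (s + r - k)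
                * Theta1 k (d mod n) n)" .
    moreover have "U d = 0"
      unfolding U_def using False by (intro sum.neutral) auto
    ultimately show ?thesis using False by (simp add: lattice_sum_def algebra_simps)
  qed
  have U: "(\<lambda>D. \<Sum>d = 1..D. U d) \<longlonglongrightarrow> ?L2"
  proof -
    have "(\<lambda>D. \<Sum>i = 0..r div 2. real ((r + s - 2 * i - 1) choose (s - 1)) * Li (2 * i) 1
      * (\<Sum>d = 1..D. if n dvd d then a ^ d * (real n / real d) ^ (r + s - 2 * i) else 0)) \<longlonglongrightarrow> ?L2"
      using s by (intro tendsto_sum tendsto_mult_left Li_multiples_LIMSEQ a n) auto
    then show ?thesis
      unfolding U_def sum.swap[of _ _ "{1.._}"] sum_distrib_left .
  qed
  have V: "(\<lambda>D. \<Sum>d = 1..D. V d) \<longlonglongrightarrow> ?L3"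
  proof -
    have "(\<lambda>D. \<Sum>i = 1..n - 1. \<Sum>k = 1..r. real ((s + r - k - 1) choose (s - 1)) * Theta1 k (n - i) n
      * (\<Sum>d = 1..D. if d mod n = n - i then a ^ d * (real n / real d) ^ (s + r - k) else 0)) \<longlonglongrightarrow> ?L3"
      using s by (intro tendsto_sum tendsto_mult_left Lerch_Phi_residue_class_LIMSEQ a) auto
    moreover have "(\<Sum>i = 1..n - 1. \<Sum>k = 1..r. real ((s + r - k - 1) choose (s - 1)) * Theta1 k (n - i) n
      * (\<Sum>d = 1..D. if d mod n = n - i then a ^ d * (real n / real d) ^ (s + r - k) else 0))
      = (\<Sum>d = 1..D. V d)" for D
      unfolding V_def sum_distrib_left
      by (subst sum.swap[of _ "{1..n - 1}" "{1..D}"], rule sum.cong[OF refl], rule sum.swap) 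
    ultimately show ?thesis by simp
  qed
  have "?F = (\<lambda>D. ((- 1) ^ r * (2 * (\<Sum>d = 1..D. a ^ d * even_zeta_sum s r (real n / real d)))
          + (1 - (- 1) ^ r) * real n ^ r * Li s (a ^ n) * Li_trunc r a D)
      + (- 1) ^ r * (2 * (\<Sum>d = 1..D. U d)) + (- 1) ^ r * (\<Sum>d = 1..D. V d))"
    unfolding split by (rule ext) (simp add: sum.distrib sum_distrib_left)
  then show ?thesis
    by (simp only:) (intro tendsto_add tendsto_mult_left U V regularised_even_zeta_LIMSEQ a r s odd)
qed

section \<open>The Euler sums\<close>

lemma euler_term_eq_Li_trunc:
  fixes a :: real
  assumes a: "a \<in> {1, - 1}"
  shows "euler_term p q n a r j = a * (a ^ (n * j) * Li_trunc r a (n * j) / real j ^ (p + q - r))"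
  unfolding euler_term_def gen_harmonic_eq_Li_trunc[OF a] by (simp add: power_mult)

text \<open>Equating the limits by rows and by columns gives a linear equation for the Euler sum, in which
  its coefficient is \<open>2 * n ^ r\<close>.\<close>

lemma euler_term_sums:
  fixes a :: real
  assumes a: "a \<in> {1, - 1}" and n: "n \<ge> 1" and odd: "odd (p + q)" and q: "q \<ge> 2" and r: "r \<in> {1..p}"
  defines "s \<equiv> p + q - r"
  shows "(\<lambda>m. euler_term p q n a r (Suc m)) sums
         (a / 2 * (1 + (- 1) ^ s) * Li s (a ^ n) * Li r a
          + a / (2 * real n ^ r) * Li (p + q) 1
          - (- 1) ^ s * real n ^ s * a * (\<Sum>i = 0..s div 2.
              real ((p + q - 2 * i - 1) choose (r - 1)) * (1 / real n ^ (2 * i))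
              * Li (2 * i) 1 * Li (p + q - 2 * i) a)
          + (- 1) ^ r * a / real n ^ r * (\<Sum>i = 0..r div 2.
              real ((p + q - 2 * i - 1) choose (s - 1))
              * Li (2 * i) 1 * Li (p + q - 2 * i) (a ^ n))
          + (- 1) ^ r * a ^ (n + 1) / (2 * real n ^ r) * (\<Sum>i = 1..n - 1. \<Sum>k = 1..r.
              real ((p + q - k - 1) choose (s - 1)) * a ^ i * (- 1) ^ k
              * Theta1 k i n * Lerch_Phi (a ^ n) (p + q - k) (real (n - i) / real n)))"
proof -
  have r1: "r \<ge> 1" and s2: "s \<ge> 2" and sr: "s + r = p + q" "r + s = p + q" and odd': "odd (s + r)"
    using r q odd by (auto simp: s_def)
  have sgn: "(- 1 :: real) ^ s = - ((- 1) ^ r)"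
    using odd' by (cases "even r") auto
  define T where "T = (\<Sum>j. a ^ (n * Suc j) * Li_trunc r a (n * Suc j) / real (Suc j) ^ s)"
  define X1 where "X1 = (\<Sum>i = 0..s div 2. real ((p + q - 2 * i - 1) choose (r - 1)) * (1 / real n ^ (2 * i))
              * Li (2 * i) 1 * Li (p + q - 2 * i) a)"
  define X2 where "X2 = (\<Sum>i = 0..r div 2. real ((p + q - 2 * i - 1) choose (s - 1))
              * Li (2 * i) 1 * Li (p + q - 2 * i) (a ^ n))"
  define X3 where "X3 = (\<Sum>i = 1..n - 1. \<Sum>k = 1..r. real ((p + q - k - 1) choose (s - 1)) * a ^ i * (- 1) ^ k
              * Theta1 k i n * Lerch_Phi (a ^ n) (p + q - k) (real (n - i) / real n))"
  have "(\<Sum>i = 0..s div 2. real ((p + q - 2 * i - 1) choose (r - 1)) * Li (2 * i) 1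
            * real n ^ (p + q - 2 * i) * Li (p + q - 2 * i) a) = real n ^ (p + q) * X1"
    unfolding X1_def sum_distrib_left
  proof (intro sum.cong refl)
    fix i assume i: "i \<in> {0..s div 2}"
    have "real n ^ (p + q - 2 * i) = real n ^ (p + q) * (1 / real n ^ (2 * i))"
    proof -
      have "2 * i \<le> p + q" using i sr by auto
      then show ?thesis using n by (simp add: power_diff)
    qed
    then show "real ((p + q - 2 * i - 1) choose (r - 1)) * Li (2 * i) 1
            * real n ^ (p + q - 2 * i) * Li (p + q - 2 * i) a
      = real n ^ (p + q) * (real ((p + q - 2 * i - 1) choose (r - 1)) * (1 / real n ^ (2 * i))
              * Li (2 * i) 1 * Li (p + q - 2 * i) a)"
      by (simp only: mult_ac)
  qed
  moreover have "(\<Sum>i = 1..n - 1. \<Sum>k = 1..r. real ((p + q - k - 1) choose (s - 1)) * Theta1 k (n - i) n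
            * (a ^ n * a ^ i * Lerch_Phi (a ^ n) (p + q - k) (real (n - i) / real n))) = a ^ n * X3"
    unfolding X3_def sum_distrib_left
  proof (intro sum.cong refl)
    fix i k assume "i \<in> {1..n - 1}" "k \<in> {1..r}"
    then have "Theta1 k (n - i) n = (- 1) ^ k * Theta1 k i n"
      by (intro Theta1_reflect) auto
    then show "real ((p + q - k - 1) choose (s - 1)) * Theta1 k (n - i) n
            * (a ^ n * a ^ i * Lerch_Phi (a ^ n) (p + q - k) (real (n - i) / real n))
      = a ^ n * (real ((p + q - k - 1) choose (s - 1)) * a ^ i * (- 1) ^ k
              * Theta1 k i n * Lerch_Phi (a ^ n) (p + q - k) (real (n - i) / real n))"
      by (simp only: mult_ac)
  qed
  ultimately have key: "2 * real n ^ r * T - Li (p + q) 1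
      = ((- 1) ^ r * (2 * (real n ^ (p + q) * X1)) + (1 - (- 1) ^ r) * real n ^ r * Li s (a ^ n) * Li r a)
        + (- 1) ^ r * (2 * X2) + (- 1) ^ r * (a ^ n * X3)"
    using LIMSEQ_unique[OF lattice_sums_LIMSEQ_by_rows[OF a n r1 s2 odd']
        lattice_sums_LIMSEQ_by_columns[OF a n r1 s2 odd']]
    unfolding sr T_def[symmetric] X2_def by (simp only:)
  have npos: "real n ^ r \<noteq> 0" using n by simp
  have npq: "real n ^ (p + q) = real n ^ r * real n ^ s"
    by (simp flip: power_add add: sr)
  have T: "T = (Li (p + q) 1 + ((- 1) ^ r * (2 * (real n ^ r * real n ^ s * X1))
        + (1 - (- 1) ^ r) * real n ^ r * Li s (a ^ n) * Li r a)
        + (- 1) ^ r * (2 * X2) + (- 1) ^ r * (a ^ n * X3)) / (2 * real n ^ r)"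
    using key npos unfolding npq by (simp add: field_simps)
  have "a * T = a / 2 * (1 + (- 1) ^ s) * Li s (a ^ n) * Li r a
          + a / (2 * real n ^ r) * Li (p + q) 1
          - (- 1) ^ s * real n ^ s * a * X1
          + (- 1) ^ r * a / real n ^ r * X2
          + (- 1) ^ r * a ^ (n + 1) / (2 * real n ^ r) * X3"
  proof -
    have "a * t = a / 2 * (1 + - e) * l * l' + a / (2 * R) * w - - e * R' * a * x1 + e * a / R * x2
          + e * (a * b) / (2 * R) * x3"
      if "t = (w + (e * (2 * (R * R' * x1)) + (1 - e) * R * l * l') + e * (2 * x2) + e * (b * x3)) / (2 * R)"
        and "R \<noteq> 0" for t w e R R' x1 l l' x2 x3 b :: real
      unfolding that(1) using that(2) by (simp add: field_simps)
    from this[OF _ npos] show ?thesis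
      unfolding sgn power_add power_one_right mult.commute[of "a ^ n" a] using T by blast
  qed
  moreover have "(\<lambda>m. euler_term p q n a r (Suc m)) sums (a * T)"
    unfolding euler_term_eq_Li_trunc[OF a] s_def[symmetric] T_def
    by (intro sums_mult summable_sums summable_euler_term a r1 s2)
  ultimately show ?thesis
    unfolding X1_def X2_def X3_def by (simp only:)
qed

section \<open>Termwise integration\<close>

lemma tendsto_times_ln_power_0: "((\<lambda>x::real. x * ln x ^ c) \<longlongrightarrow> 0) (at_right 0)"
proof -
  have "((\<lambda>x::real. (- ln x) ^ c / exp (- ln x)) \<longlongrightarrow> 0) (at_right 0)"
    by (rule filterlim_compose[OF tendsto_power_div_exp_0])
       (intro filterlim_compose[OF filterlim_uminus_at_top_at_bot] ln_at_0)
  then have "((\<lambda>x::real. (- 1) ^ c * ((- ln x) ^ c / exp (- ln x))) \<longlongrightarrow> 0) (at_right 0)"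
    by (rule tendsto_mult_right_zero)
  moreover have "eventually (\<lambda>x::real. (- 1) ^ c * ((- ln x) ^ c / exp (- ln x)) = x * ln x ^ c) (at_right 0)"
    using eventually_at_right_less[of 0]
  proof eventually_elim
    case (elim x)
    have "(- 1) ^ c * (- ln x) ^ c = ln x ^ c"
      by (simp flip: power_mult_distrib)
    then show ?case using elim by (simp add: exp_minus field_simps)
  qed
  ultimately show ?thesis by (rule Lim_transform_eventually)
qed

text \<open>Each integration by parts lowers \<open>c\<close> by one; the boundary terms of \<open>x ^ Suc m * ln x ^ c\<close>
  vanish for \<open>c > 0\<close>.\<close>

lemma has_integral_power_ln:
  "((\<lambda>x. x ^ m * ln x ^ c) has_integral (- 1) ^ c * fact c / real (Suc m) ^ Suc c) {0..1}"
proof -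
  have cont: "continuous_on {0..1} (\<lambda>x::real. x ^ Suc m * ln x ^ c)" for c
  proof (rule continuous_on_IccI)
    have "((\<lambda>x::real. x ^ m * (x * ln x ^ c)) \<longlongrightarrow> 0 ^ m * 0) (at_right 0)"
      by (intro tendsto_mult tendsto_power tendsto_times_ln_power_0 tendsto_ident_at)
    then show "((\<lambda>x::real. x ^ Suc m * ln x ^ c) \<longlongrightarrow> 0 ^ Suc m * ln 0 ^ c) (at_right 0)"
      by (simp add: mult_ac)
    show "((\<lambda>x::real. x ^ Suc m * ln x ^ c) \<longlongrightarrow> 1 ^ Suc m * ln 1 ^ c) (at_left 1)"
      by (intro tendsto_intros) auto
    show "((\<lambda>x::real. x ^ Suc m * ln x ^ c) \<longlongrightarrow> x ^ Suc m * ln x ^ c) (at x)" if "0 < x" "x < 1" for x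
      using that by (intro tendsto_intros) auto
  qed simp
  show ?thesis
  proof (induction c)
    case 0
    have "((\<lambda>x. real (Suc m) * x ^ m) has_integral 1 ^ Suc m * ln 1 ^ 0 - 0 ^ Suc m * ln 0 ^ 0) {0..1::real}"
    proof (rule fundamental_theorem_of_calculus_interior[OF _ cont[of 0]])
      fix x :: real
      have "((\<lambda>x. x ^ Suc m * ln x ^ 0) has_real_derivative real (Suc m) * x ^ m) (at x)"
        unfolding power_0 mult_1_right using DERIV_pow[of "Suc m" x UNIV] by simp
      then show "((\<lambda>x. x ^ Suc m * ln x ^ 0) has_vector_derivative real (Suc m) * x ^ m) (at x)"
        by (simp only: has_real_derivative_iff_has_vector_derivative)
    qed simp
    from has_integral_mult_right[OF this, of "1 / real (Suc m)"] show ?case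
      by simp
  next
    case (Suc c)
    have "((\<lambda>x. real (Suc m) * (x ^ m * ln x ^ Suc c) + real (Suc c) * (x ^ m * ln x ^ c))
        has_integral 1 ^ Suc m * ln 1 ^ Suc c - 0 ^ Suc m * ln 0 ^ Suc c) {0..1::real}"
    proof (rule fundamental_theorem_of_calculus_interior[OF _ cont[of "Suc c"]])
      fix x :: real
      assume x: "x \<in> {0<..<1}"
      have "((\<lambda>x. x ^ Suc m * ln x ^ Suc c) has_real_derivative
          (real (Suc m) * x ^ m) * ln x ^ Suc c + (real (Suc c) * ln x ^ c * (1 / x)) * x ^ Suc m) (at x)"
        by (intro DERIV_mult DERIV_chain2[where f = "\<lambda>y. y ^ Suc c" and g = ln])
           (use x DERIV_pow[of "Suc m" x UNIV] DERIV_pow[of "Suc c" "ln x" UNIV] DERIV_ln_divide[of x] in auto)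
      also have "(real (Suc m) * x ^ m) * ln x ^ Suc c + (real (Suc c) * ln x ^ c * (1 / x)) * x ^ Suc m
          = real (Suc m) * (x ^ m * ln x ^ Suc c) + real (Suc c) * (x ^ m * ln x ^ c)"
        using x by simp
      finally show "((\<lambda>x. x ^ Suc m * ln x ^ Suc c) has_vector_derivative
          real (Suc m) * (x ^ m * ln x ^ Suc c) + real (Suc c) * (x ^ m * ln x ^ c)) (at x)"
        by (simp only: has_real_derivative_iff_has_vector_derivative)
    qed simp
    then have "((\<lambda>x::real. (real (Suc m) * (x ^ m * ln x ^ Suc c) + real (Suc c) * (x ^ m * ln x ^ c))
        - real (Suc c) * (x ^ m * ln x ^ c)) has_integral
          0 - real (Suc c) * ((- 1) ^ c * fact c / real (Suc m) ^ Suc c)) {0..1}"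
      by (intro has_integral_diff has_integral_mult_right Suc) simp
    then have "((\<lambda>x::real. (1 / real (Suc m)) * (real (Suc m) * (x ^ m * ln x ^ Suc c))) has_integral
          (1 / real (Suc m)) * (0 - real (Suc c) * ((- 1) ^ c * fact c / real (Suc m) ^ Suc c))) {0..1}"
      by (intro has_integral_mult_right) simp
    moreover have "(1 / real (Suc m)) * (0 - real (Suc c) * ((- 1) ^ c * fact c / real (Suc m) ^ Suc c))
        = (- 1) ^ Suc c * fact (Suc c) / real (Suc m) ^ Suc (Suc c)"
      by (simp add: mult_ac)
    moreover have "(1 / real (Suc m)) * (real (Suc m) * y) = y" for y
      by simp
    ultimately show ?case by (simp only:)
  qed
qed

abbreviation unit_interval_measure :: "real measure" where
  "unit_interval_measure \<equiv> lebesgue_on {0<..<1}"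

lemma abs_power_ln:
  fixes x :: real
  assumes "x \<in> {0<..<1}"
  shows "\<bar>x ^ m * ln x ^ c\<bar> = (- 1) ^ c * (x ^ m * ln x ^ c)"
proof -
  have "\<bar>ln x\<bar> = - ln x" using assms by simp
  then have "\<bar>ln x ^ c\<bar> = (- 1) ^ c * ln x ^ c"
    by (simp add: power_abs flip: power_mult_distrib)
  then show ?thesis using assms by (simp add: abs_mult)
qed

lemma integrable_power_ln: "integrable unit_interval_measure (\<lambda>x. x ^ m * ln x ^ c)"
  and integral_power_ln: "(LINT x|unit_interval_measure. x ^ m * ln x ^ c) = (- 1) ^ c * fact c / real (Suc m) ^ Suc c"
  and integral_abs_power_ln: "(LINT x|unit_interval_measure. \<bar>x ^ m * ln x ^ c\<bar>) = fact c / real (Suc m) ^ Suc c"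
proof -
  have 1: "((\<lambda>x. x ^ m * ln x ^ c) has_integral (- 1) ^ c * fact c / real (Suc m) ^ Suc c) {0<..<1}"
    using has_integral_power_ln[of m c] by (simp only: has_integral_Icc_iff_Ioo)
  have "(\<lambda>x::real. (- 1) ^ c * (x ^ m * ln x ^ c)) integrable_on {0<..<1}"
    by (rule has_integral_integrable[OF has_integral_mult_right[OF 1]])
  then have "(\<lambda>x::real. (- 1) ^ c * (x ^ m * ln x ^ c)) absolutely_integrable_on {0<..<1}"
    by (rule nonnegative_absolutely_integrable_1) (use abs_power_ln in \<open>metis abs_ge_zero\<close>)
  then have "integrable unit_interval_measure (\<lambda>x. (- 1) ^ c * (x ^ m * ln x ^ c))"
    by (rule absolutely_integrable_imp_integrable) simp
  from integrable_mult_right[OF this, of "(- 1) ^ c"]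
  show 2: "integrable unit_interval_measure (\<lambda>x. x ^ m * ln x ^ c)"
    by (simp flip: mult.assoc power_mult_distrib)
  show 3: "(LINT x|unit_interval_measure. x ^ m * ln x ^ c) = (- 1) ^ c * fact c / real (Suc m) ^ Suc c"
    by (rule has_integral_unique[OF has_integral_integral_lebesgue_on[OF 2] 1]) simp
  have "(LINT x|unit_interval_measure. \<bar>x ^ m * ln x ^ c\<bar>)
      = (LINT x|unit_interval_measure. (- 1) ^ c * (x ^ m * ln x ^ c))"
    by (intro Bochner_Integration.integral_cong refl abs_power_ln) simp
  also have "\<dots> = (- 1) ^ c * ((- 1) ^ c * fact c / real (Suc m) ^ Suc c)"
    using 3 by simp
  finally show "(LINT x|unit_interval_measure. \<bar>x ^ m * ln x ^ c\<bar>) = fact c / real (Suc m) ^ Suc c"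
    by (simp flip: mult.assoc power_mult_distrib)
qed

lemma Li_interior_sums:
  fixes a x :: real
  assumes a: "a \<in> {1, - 1}" and x: "x \<in> {0<..<1}" and q: "q \<ge> 2"
  shows "(\<lambda>k. a ^ Suc k / real (Suc k) ^ q * x ^ Suc k) sums Li q (a * x)"
    and "summable (\<lambda>k. \<bar>a ^ Suc k / real (Suc k) ^ q * x ^ Suc k\<bar>)"
proof -
  have bound: "\<bar>a ^ Suc k / real (Suc k) ^ q * x ^ Suc k\<bar> \<le> 1 / real (Suc k) ^ q" for k
  proof -
    have "x ^ Suc k \<le> 1" using x by (intro power_le_one) auto
    then show ?thesis
      using sign_powers(1)[OF a, of "Suc k"] x
      by (simp add: abs_mult divide_right_mono mult.commute del: power_Suc)
  qed
  show abs: "summable (\<lambda>k. \<bar>a ^ Suc k / real (Suc k) ^ q * x ^ Suc k\<bar>)"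
    by (rule summable_comparison_test'[OF summable_inverse_Suc_power[OF q], of 0]) (use bound in auto)
  have "(\<lambda>k. a ^ Suc k / real (Suc k) ^ q * x ^ Suc k) sums (\<Sum>k. a ^ Suc k / real (Suc k) ^ q * x ^ Suc k)"
    by (rule summable_sums[OF summable_rabs_cancel[OF abs]])
  also have "(\<Sum>k. a ^ Suc k / real (Suc k) ^ q * x ^ Suc k) = Li q (a * x)"
  proof -
    have "a * x \<noteq> 1" using a x by auto
    then show ?thesis
      unfolding Li_def by (simp add: power_mult_distrib mult_ac)
  qed
  finally show "(\<lambda>k. a ^ Suc k / real (Suc k) ^ q * x ^ Suc k) sums Li q (a * x)" .
qed

text \<open>The factor \<open>x\<close> compensates the factor \<open>1 / x\<close> in the integrand, which is not integrable
  at 0.\<close>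

lemma abs_Li_interior_le:
  fixes a x :: real
  assumes a: "a \<in> {1, - 1}" and x: "x \<in> {0<..<1}" and q: "q \<ge> 2"
  shows "\<bar>Li q (a * x)\<bar> \<le> x * Li q 1"
proof -
  have "norm (\<Sum>k. a ^ Suc k / real (Suc k) ^ q * x ^ Suc k) \<le> (\<Sum>k. x * (1 / real (Suc k) ^ q))"
  proof (rule norm_suminf_le)
    show "summable (\<lambda>k. x * (1 / real (Suc k) ^ q))"
      by (intro summable_mult summable_inverse_Suc_power q)
    fix k
    have "x ^ Suc k \<le> x ^ 1" using x by (intro power_decreasing) auto
    then show "norm (a ^ Suc k / real (Suc k) ^ q * x ^ Suc k) \<le> x * (1 / real (Suc k) ^ q)"
      using sign_powers(1)[OF a, of "Suc k"] x
      by (simp add: abs_mult divide_right_mono mult.commute del: power_Suc)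
  qed
  also have "(\<Sum>k. x * (1 / real (Suc k) ^ q)) = x * Li q 1"
    using sums_inverse_power[OF q] by (intro sums_unique[symmetric] sums_mult)
  finally show ?thesis
    using sums_unique[OF Li_interior_sums(1)[OF assms]] by simp
qed

text \<open>The integral of one term of the geometric series, up to \<open>(- 1) ^ (p - 1) * fact (p - 1)\<close>.\<close>

definition shifted_Li_series :: "nat \<Rightarrow> nat \<Rightarrow> real \<Rightarrow> nat \<Rightarrow> real" where
  "shifted_Li_series p q a N = (\<Sum>k. a ^ Suc k / (real (Suc k) ^ q * real (Suc k + N) ^ p))"

lemma shifted_Li_series_summable:
  fixes a :: real
  assumes a: "a \<in> {1, - 1}" and q: "q \<ge> 2"
  shows "summable (\<lambda>k. \<bar>a ^ Suc k / (real (Suc k) ^ q * real (Suc k + N) ^ p)\<bar>)"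
proof (rule summable_comparison_test'[OF summable_inverse_Suc_power[OF q], of 0])
  fix k
  have "real (Suc k) ^ q * 1 \<le> real (Suc k) ^ q * real (Suc k + N) ^ p"
    by (intro mult_left_mono one_le_power) auto
  then have "1 / (real (Suc k) ^ q * real (Suc k + N) ^ p) \<le> 1 / real (Suc k) ^ q"
    by (intro divide_left_mono) auto
  then show "norm \<bar>a ^ Suc k / (real (Suc k) ^ q * real (Suc k + N) ^ p)\<bar> \<le> 1 / real (Suc k) ^ q"
    using sign_powers(1)[OF a, of "Suc k"] by (simp add: abs_mult del: power_Suc of_nat_Suc of_nat_add)
qed

lemma integral_power_ln_Li:
  fixes a :: real and N c :: nat
  assumes a: "a \<in> {1, - 1}" and q: "q \<ge> 2"
  defines "G \<equiv> \<lambda>x. x ^ N / x * ln x ^ c * Li q (a * x)"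
  shows "integrable unit_interval_measure G"
    and "(LINT x|unit_interval_measure. G x) = (- 1) ^ c * fact c * shifted_Li_series (Suc c) q a N"
    and "(LINT x|unit_interval_measure. norm (G x)) \<le> Li q 1 * (fact c / real (Suc N) ^ Suc c)"
proof -
  define g where "g k x = a ^ Suc k / real (Suc k) ^ q * (x ^ (k + N) * ln x ^ c)" for k and x :: real
  have g_eq: "g k x = x ^ N / x * ln x ^ c * (a ^ Suc k / real (Suc k) ^ q * x ^ Suc k)"
    if "x \<in> {0<..<1}" for k x
    using that by (simp add: g_def power_add)
  have int: "integrable unit_interval_measure (g k)" for k
    unfolding g_def by (intro integrable_mult_right integrable_power_ln)
  have val: "(LINT x|unit_interval_measure. g k x)
      = (- 1) ^ c * fact c * (a ^ Suc k / (real (Suc k) ^ q * real (Suc k + N) ^ Suc c))" for k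
    unfolding g_def integral_mult_right_zero integral_power_ln by (simp add: mult_ac)
  have abs: "(LINT x|unit_interval_measure. norm (g k x))
      = fact c * \<bar>a ^ Suc k / (real (Suc k) ^ q * real (Suc k + N) ^ Suc c)\<bar>" for k
    unfolding g_def real_norm_def abs_mult[of "_ / _"] integral_mult_right_zero integral_abs_power_ln
    by (simp add: abs_mult mult_ac)
  have pointwise: "AE x in unit_interval_measure. summable (\<lambda>k. norm (g k x))"
  proof (rule AE_I2)
    fix x assume "x \<in> space unit_interval_measure"
    then have x: "x \<in> {0<..<1}" by simp
    have "summable (\<lambda>k. \<bar>x ^ N / x * ln x ^ c\<bar> * \<bar>a ^ Suc k / real (Suc k) ^ q * x ^ Suc k\<bar>)"
      by (intro summable_mult Li_interior_sums(2) a x q)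
    then show "summable (\<lambda>k. norm (g k x))"
      by (simp only: g_eq[OF x] real_norm_def abs_mult)
  qed
  have sums_abs: "summable (\<lambda>k. LINT x|unit_interval_measure. norm (g k x))"
    unfolding abs by (intro summable_mult shifted_Li_series_summable a q)
  have G: "(\<Sum>k. g k x) = G x" if "x \<in> space unit_interval_measure" for x
  proof -
    have x: "x \<in> {0<..<1}" using that by simp
    show ?thesis
      unfolding g_eq[OF x] G_def
      by (intro sums_unique[symmetric] sums_mult Li_interior_sums(1) a x q)
  qed
  have "integrable unit_interval_measure (\<lambda>x. \<Sum>k. g k x)"
    by (rule integrable_suminf[OF int pointwise sums_abs])
  then show "integrable unit_interval_measure G"
    by (subst (asm) Bochner_Integration.integrable_cong[where f = "\<lambda>x. \<Sum>k. g k x", OF refl G])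
  have "(LINT x|unit_interval_measure. G x) = (LINT x|unit_interval_measure. (\<Sum>k. g k x))"
    by (intro Bochner_Integration.integral_cong refl G[symmetric])
  also have "\<dots> = (\<Sum>k. LINT x|unit_interval_measure. g k x)"
    by (rule integral_suminf[OF int pointwise sums_abs])
  also have "\<dots> = (- 1) ^ c * fact c * shifted_Li_series (Suc c) q a N"
    unfolding val shifted_Li_series_def
    by (intro suminf_mult summable_rabs_cancel[OF shifted_Li_series_summable] a q)
  finally show "(LINT x|unit_interval_measure. G x) = (- 1) ^ c * fact c * shifted_Li_series (Suc c) q a N" .
  have "(LINT x|unit_interval_measure. norm (G x))
      \<le> (LINT x|unit_interval_measure. Li q 1 * \<bar>x ^ N * ln x ^ c\<bar>)"
  proof (rule integral_mono)
    show "integrable unit_interval_measure (\<lambda>x. norm (G x))"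
      by (intro integrable_norm \<open>integrable unit_interval_measure G\<close>)
    show "integrable unit_interval_measure (\<lambda>x. Li q 1 * \<bar>x ^ N * ln x ^ c\<bar>)"
      by (intro integrable_mult_right integrable_abs integrable_power_ln)
    fix x assume "x \<in> space unit_interval_measure"
    then have x: "x \<in> {0<..<1}" by simp
    have "norm (G x) = \<bar>x ^ N * ln x ^ c\<bar> / x * \<bar>Li q (a * x)\<bar>"
      using x by (simp add: G_def abs_mult)
    also have "\<dots> \<le> \<bar>x ^ N * ln x ^ c\<bar> / x * (x * Li q 1)"
      using x by (intro mult_left_mono abs_Li_interior_le a q) auto
    also have "\<dots> = Li q 1 * \<bar>x ^ N * ln x ^ c\<bar>" using x by simp
    finally show "norm (G x) \<le> Li q 1 * \<bar>x ^ N * ln x ^ c\<bar>" .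
  qed
  also have "\<dots> = Li q 1 * (fact c / real (Suc N) ^ Suc c)"
    by (simp only: integral_mult_right_zero integral_abs_power_ln)
  finally show "(LINT x|unit_interval_measure. norm (G x)) \<le> Li q 1 * (fact c / real (Suc N) ^ Suc c)" .
qed

lemma has_integral_ln_Li_geometric:
  fixes a :: real
  assumes a: "a \<in> {1, - 1}" and q: "q \<ge> 2" and n: "n \<ge> 1" and p: "p \<ge> 2"
  shows "\<exists>I. (\<lambda>j. (- 1) ^ (p - 1) * fact (p - 1) * shifted_Li_series p q a (n * j)) sums I \<and>
    ((\<lambda>x. ln x ^ (p - 1) * Li q (a * x) / (x * (1 - x ^ n))) has_integral I) {0<..<1}"
proof -
  define c where "c = p - 1"
  have pc: "p = Suc c" and c: "c \<ge> 1" using p by (auto simp: c_def)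
  define G where "G j x = x ^ (n * j) / x * ln x ^ c * Li q (a * x)" for j and x :: real
  have int: "integrable unit_interval_measure (G j)" for j
    unfolding G_def by (rule integral_power_ln_Li(1)[OF a q])
  have geometric: "(\<lambda>j. (x ^ n) ^ j) sums (1 / (1 - x ^ n))" if "x \<in> {0<..<1}" for x :: real
  proof (rule geometric_sums)
    have "x ^ n < 1 ^ n" using that n by (intro power_strict_mono) auto
    then show "norm (x ^ n) < 1" using that by simp
  qed
  have pointwise: "AE x in unit_interval_measure. summable (\<lambda>j. norm (G j x))"
  proof (rule AE_I2)
    fix x assume "x \<in> space unit_interval_measure"
    then have x: "x \<in> {0<..<1}" by simp
    have "summable (\<lambda>j. \<bar>1 / x * ln x ^ c * Li q (a * x)\<bar> * (x ^ n) ^ j)"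
      by (intro summable_mult sums_summable[OF geometric] x)
    moreover have "norm (G j x) = \<bar>1 / x * ln x ^ c * Li q (a * x)\<bar> * (x ^ n) ^ j" for j
      using x by (simp add: G_def abs_mult power_mult)
    ultimately show "summable (\<lambda>j. norm (G j x))" by simp
  qed
  have sums_abs: "summable (\<lambda>j. LINT x|unit_interval_measure. norm (G j x))"
  proof (rule summable_comparison_test'[of "\<lambda>j. Li q 1 * fact c * (1 / real (Suc j) ^ Suc c)" 0])
    show "summable (\<lambda>j. Li q 1 * fact c * (1 / real (Suc j) ^ Suc c))"
      using c by (intro summable_mult summable_inverse_Suc_power) auto
    fix j
    have "Li q 1 \<ge> 0"
      by (rule sums_le[OF _ sums_zero sums_inverse_power[OF q]]) simp
    have "(LINT x|unit_interval_measure. norm (G j x)) \<le> Li q 1 * (fact c / real (Suc (n * j)) ^ Suc c)"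
      unfolding G_def by (rule integral_power_ln_Li(3)[OF a q])
    also have "\<dots> \<le> Li q 1 * (fact c / real (Suc j) ^ Suc c)"
    proof -
      have "Suc j \<le> Suc (n * j)" using n by simp
      then have "real (Suc j) ^ Suc c \<le> real (Suc (n * j)) ^ Suc c"
        by (intro power_mono) (simp_all only: of_nat_le_iff of_nat_0_le_iff)
      then show ?thesis
        using \<open>Li q 1 \<ge> 0\<close> by (intro mult_left_mono frac_le) auto
    qed
    finally show "norm (LINT x|unit_interval_measure. norm (G j x)) \<le> Li q 1 * fact c * (1 / real (Suc j) ^ Suc c)"
      by simp
  qed
  define F where "F x = ln x ^ (p - 1) * Li q (a * x) / (x * (1 - x ^ n))" for x
  have F: "(\<Sum>j. G j x) = F x" if "x \<in> space unit_interval_measure" for x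
  proof -
    have x: "x \<in> {0<..<1}" using that by simp
    have "(\<lambda>j. 1 / x * ln x ^ c * Li q (a * x) * (x ^ n) ^ j) sums (1 / x * ln x ^ c * Li q (a * x) * (1 / (1 - x ^ n)))"
      by (intro sums_mult geometric x)
    moreover have "G j x = 1 / x * ln x ^ c * Li q (a * x) * (x ^ n) ^ j" for j
      unfolding G_def power_mult by simp
    moreover have "F x = 1 / x * ln x ^ c * Li q (a * x) * (1 / (1 - x ^ n))"
      by (simp add: F_def c_def)
    ultimately have "(\<lambda>j. G j x) sums F x"
      by (simp only:)
    then show ?thesis by (rule sums_unique[symmetric])
  qed
  have "integrable unit_interval_measure (\<lambda>x. \<Sum>j. G j x)"
    by (rule integrable_suminf[OF int pointwise sums_abs])
  then have "integrable unit_interval_measure F"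
    by (subst (asm) Bochner_Integration.integrable_cong[OF refl F])
  then have "(F has_integral (LINT x|unit_interval_measure. F x)) {0<..<1}"
    by (rule has_integral_integral_lebesgue_on) simp
  moreover have "(\<lambda>j. LINT x|unit_interval_measure. G j x) sums (LINT x|unit_interval_measure. (\<Sum>j. G j x))"
    by (rule sums_integral[OF int pointwise sums_abs])
  moreover have "(LINT x|unit_interval_measure. (\<Sum>j. G j x)) = (LINT x|unit_interval_measure. F x)"
    by (intro Bochner_Integration.integral_cong refl F)
  moreover have "(LINT x|unit_interval_measure. G j x) = (- 1) ^ c * fact c * shifted_Li_series p q a (n * j)" for j
    unfolding G_def pc by (rule integral_power_ln_Li(2)[OF a q])
  ultimately show ?thesis
    unfolding F_def c_def by auto
qed

section \<open>Evaluation of the series for the integral\<close>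

lemma shifted_Li_series_0:
  fixes a :: real
  assumes a: "a \<in> {1, - 1}" and q: "q \<ge> 2"
  shows "shifted_Li_series p q a 0 = Li (p + q) a"
proof -
  have "(\<lambda>k. a ^ Suc k / real (Suc k) ^ (p + q)) sums Li (p + q) a"
    using q by (intro Li_sums a) auto
  then show ?thesis
    unfolding shifted_Li_series_def by (simp add: power_add mult.commute sums_iff)
qed

text \<open>Both sums of partial fractions contain \<open>Li 1 a\<close>, with opposite coefficients up to the factor
  \<open>a ^ N\<close>.  For \<open>a = 1\<close> the two harmonic series diverge, but only their difference matters,
  and any finite value assigned to \<open>Li 1 1\<close>, such as 0, cancels.\<close>

lemma shifted_Li_series_eq:
  fixes a :: real
  assumes a: "a \<in> {1, - 1}" and q: "q \<ge> 2" and p: "p \<ge> 2" and N: "N \<ge> 1"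
  shows "shifted_Li_series p q a N =
      (- 1) ^ q * (\<Sum>l = 1..q. real ((p + q - l - 1) choose (p - 1)) / real N ^ (p + q - l) * ((- 1) ^ l * Li l a))
    + (- 1) ^ q * (\<Sum>r = 1..p. real ((p + q - r - 1) choose (q - 1)) / real N ^ (p + q - r)
        * (a ^ N * (Li r a - Li_trunc r a N)))"
proof -
  define A where "A r = real ((p + q - r - 1) choose (q - 1)) / real N ^ (p + q - r)" for r
  define B where "B l = real ((p + q - l - 1) choose (p - 1)) / real N ^ (p + q - l)" for l
  define R where "R m K = Li_trunc m a K - Li m a" for m K
  have AB: "A 1 = B 1"
  proof -
    have "p + q - 1 - 1 - (q - 1) = p - 1" using p q by simp
    then show ?thesis
      using binomial_symmetric[of "q - 1" "p + q - 1 - 1"] p q by (simp add: A_def B_def)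
  qed
  have decomp: "a ^ k / (real k ^ q * real (k + N) ^ p)
      = (- 1) ^ q * (\<Sum>r = 1..p. A r * (a ^ k / (real N + real k) ^ r))
      + (- 1) ^ q * (\<Sum>l = 1..q. B l * ((- 1) ^ l * (a ^ k / real k ^ l)))" if "k \<in> {1..K}" for k K
  proof -
    have "1 / (real (k + N) ^ p * (real (k + N) - real N) ^ q)
      = (- 1) ^ q * (\<Sum>r = 1..p. A r * (1 / real (k + N) ^ r))
      + (- 1) ^ q * (\<Sum>l = 1..q. B l * ((- 1) ^ l / (real (k + N) - real N) ^ l))"
      unfolding A_def B_def using that N p q by (intro partial_fractions) auto
    then have "a ^ k * (1 / (real (k + N) ^ p * real k ^ q))
      = a ^ k * ((- 1) ^ q * (\<Sum>r = 1..p. A r * (1 / (real N + real k) ^ r))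
      + (- 1) ^ q * (\<Sum>l = 1..q. B l * ((- 1) ^ l / real k ^ l)))"
      by (simp add: add.commute)
    then show ?thesis
      by (simp add: distrib_left sum_distrib_left mult_ac)
  qed
  have partial: "(\<Sum>k = 1..K. a ^ k / (real k ^ q * real (k + N) ^ p))
      = ((- 1) ^ q * (\<Sum>l = 1..q. B l * ((- 1) ^ l * Li l a))
        + (- 1) ^ q * (\<Sum>r = 1..p. A r * (a ^ N * (Li r a - Li_trunc r a N))))
      + ((- 1) ^ q * (\<Sum>r = 1..p. A r * (a ^ N * R r (N + K))) + (- 1) ^ q * (\<Sum>l = 1..q. B l * ((- 1) ^ l * R l K)))" for K
  proof -
    have "(\<Sum>k = 1..K. a ^ k / (real k ^ q * real (k + N) ^ p))
       = (\<Sum>k = 1..K. (- 1) ^ q * (\<Sum>r = 1..p. A r * (a ^ k / (real N + real k) ^ r))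
      + (- 1) ^ q * (\<Sum>l = 1..q. B l * ((- 1) ^ l * (a ^ k / real k ^ l))))"
      by (intro sum.cong refl decomp)
    also have "\<dots> = (- 1) ^ q * (\<Sum>r = 1..p. A r * (\<Sum>k = 1..K. a ^ k / (real N + real k) ^ r))
      + (- 1) ^ q * (\<Sum>l = 1..q. B l * ((- 1) ^ l * (\<Sum>k = 1..K. a ^ k / real k ^ l)))"
    proof -
      have "(\<Sum>k = 1..K. \<Sum>r = 1..p. A r * (a ^ k / (real N + real k) ^ r))
          = (\<Sum>r = 1..p. A r * (\<Sum>k = 1..K. a ^ k / (real N + real k) ^ r))"
        by (subst sum.swap) (simp only: sum_distrib_left)
      moreover have "(\<Sum>k = 1..K. \<Sum>l = 1..q. B l * ((- 1) ^ l * (a ^ k / real k ^ l)))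
          = (\<Sum>l = 1..q. B l * ((- 1) ^ l * (\<Sum>k = 1..K. a ^ k / real k ^ l)))"
        by (subst sum.swap) (simp only: sum_distrib_left)
      ultimately show ?thesis
        unfolding sum.distrib sum_distrib_left[symmetric] by (simp only:)
    qed
    also have "\<dots> = (- 1) ^ q * (\<Sum>r = 1..p. A r * (a ^ N * (Li_trunc r a (N + K) - Li_trunc r a N)))
      + (- 1) ^ q * (\<Sum>l = 1..q. B l * ((- 1) ^ l * Li_trunc l a K))"
      unfolding sum_window_right[OF a] Li_trunc_def[symmetric] ..
    also have "(\<Sum>r = 1..p. A r * (a ^ N * (Li_trunc r a (N + K) - Li_trunc r a N)))
        = (\<Sum>r = 1..p. A r * (a ^ N * (Li r a - Li_trunc r a N))) + (\<Sum>r = 1..p. A r * (a ^ N * R r (N + K)))"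
      by (simp add: R_def algebra_simps flip: sum.distrib)
    also have "(\<Sum>l = 1..q. B l * ((- 1) ^ l * Li_trunc l a K))
        = (\<Sum>l = 1..q. B l * ((- 1) ^ l * Li l a)) + (\<Sum>l = 1..q. B l * ((- 1) ^ l * R l K))"
      by (simp add: R_def algebra_simps flip: sum.distrib)
    finally show ?thesis by (simp add: distrib_left)
  qed
  have R0: "R m \<longlonglongrightarrow> 0" if "m \<ge> 2 \<or> m = 1 \<and> a = - 1" for m
    unfolding R_def using tendsto_diff[OF Li_trunc_LIMSEQ[OF a that] tendsto_const[of "Li m a"]] by simp
  have R0': "(\<lambda>K. R m (N + K)) \<longlonglongrightarrow> 0" if "m \<ge> 2 \<or> m = 1 \<and> a = - 1" for m
    using LIMSEQ_ignore_initial_segment[OF R0[OF that], of N] by (simp add: add.commute)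
  \<comment> \<open>For \<open>a = 1\<close> neither remainder converges; their difference is a block of \<open>N\<close> terms of the
    harmonic series moving to infinity.\<close>
  have one: "(\<lambda>K. a ^ N * R 1 (N + K) - R 1 K) \<longlonglongrightarrow> 0"
  proof (cases "a = 1")
    case True
    then show ?thesis
      using Li_trunc_shift_LIMSEQ[OF a, of 1 N] by (simp add: R_def add.commute)
  next
    case False
    then have "a = - 1" using a by auto
    then have "(\<lambda>K. a ^ N * R 1 (N + K) - R 1 K) \<longlonglongrightarrow> a ^ N * 0 - 0"
      by (intro tendsto_diff tendsto_mult_left R0 R0') auto
    then show ?thesis by simp
  qed
  have peel: "(\<Sum>i = 1..m. f i) = f 1 + (\<Sum>i = 2..m. f i)" if "m \<ge> 2" for f :: "nat \<Rightarrow> real" and m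
    using that by (simp add: sum.atLeast_Suc_atMost numeral_2_eq_2)
  have "(\<lambda>K. (- 1) ^ q * (A 1 * (a ^ N * R 1 (N + K) - R 1 K)
      + ((\<Sum>r = 2..p. A r * (a ^ N * R r (N + K))) + (\<Sum>l = 2..q. B l * ((- 1) ^ l * R l K)))))
     \<longlonglongrightarrow> (- 1) ^ q * (A 1 * 0 + ((\<Sum>r = 2..p. A r * (a ^ N * 0)) + (\<Sum>l = 2..q. B l * ((- 1) ^ l * 0))))"
    by (intro tendsto_mult_left tendsto_add tendsto_sum one R0 R0') auto
  also have "(\<lambda>K. (- 1) ^ q * (A 1 * (a ^ N * R 1 (N + K) - R 1 K)
      + ((\<Sum>r = 2..p. A r * (a ^ N * R r (N + K))) + (\<Sum>l = 2..q. B l * ((- 1) ^ l * R l K)))))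
      = (\<lambda>K. (- 1) ^ q * (\<Sum>r = 1..p. A r * (a ^ N * R r (N + K))) + (- 1) ^ q * (\<Sum>l = 1..q. B l * ((- 1) ^ l * R l K)))"
    unfolding peel[OF p] peel[OF q] AB by (simp add: algebra_simps)
  finally have rest: "(\<lambda>K. (- 1) ^ q * (\<Sum>r = 1..p. A r * (a ^ N * R r (N + K)))
      + (- 1) ^ q * (\<Sum>l = 1..q. B l * ((- 1) ^ l * R l K))) \<longlonglongrightarrow> 0"
    by simp
  have "(\<lambda>K. \<Sum>k = 1..K. a ^ k / (real k ^ q * real (k + N) ^ p)) \<longlonglongrightarrow>
      ((- 1) ^ q * (\<Sum>l = 1..q. B l * ((- 1) ^ l * Li l a))
        + (- 1) ^ q * (\<Sum>r = 1..p. A r * (a ^ N * (Li r a - Li_trunc r a N)))) + 0"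
    unfolding partial by (intro tendsto_add[OF tendsto_const rest])
  then have "(\<lambda>k. a ^ Suc k / (real (Suc k) ^ q * real (Suc k + N) ^ p)) sums
      ((- 1) ^ q * (\<Sum>l = 1..q. B l * ((- 1) ^ l * Li l a))
        + (- 1) ^ q * (\<Sum>r = 1..p. A r * (a ^ N * (Li r a - Li_trunc r a N))))"
    unfolding sums_Suc_iff_LIMSEQ[of "\<lambda>k. a ^ k / (real k ^ q * real (k + N) ^ p)"] by simp
  then show ?thesis
    unfolding shifted_Li_series_def A_def B_def by (rule sums_unique[symmetric])
qed

lemma shifted_Li_series_multiples_sums:
  fixes a :: real
  assumes a: "a \<in> {1, - 1}" and q: "q \<ge> 2" and p: "p \<ge> 2" and n: "n \<ge> 1"
  shows "(\<lambda>j. shifted_Li_series p q a (n * Suc j)) sums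
    ((- 1) ^ q * (\<Sum>l = 1..q. real ((p + q - l - 1) choose (p - 1)) / real n ^ (p + q - l)
        * ((- 1) ^ l * Li l a * Li (p + q - l) 1))
    + (- 1) ^ q * (\<Sum>r = 1..p. real ((p + q - r - 1) choose (q - 1)) / real n ^ (p + q - r)
        * (Li r a * Li (p + q - r) (a ^ n) - a * euler_sum p q n a r)))"
proof -
  have scale: "C / real (n * Suc j) ^ m * X = C / real n ^ m * (X / real (Suc j) ^ m)" for C X j m
    unfolding of_nat_mult power_mult_distrib by simp
  have eq: "shifted_Li_series p q a (n * Suc j)
    = (- 1) ^ q * (\<Sum>l = 1..q. real ((p + q - l - 1) choose (p - 1)) / real n ^ (p + q - l)
        * ((- 1) ^ l * Li l a * (1 / real (Suc j) ^ (p + q - l))))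
    + (- 1) ^ q * (\<Sum>r = 1..p. real ((p + q - r - 1) choose (q - 1)) / real n ^ (p + q - r)
        * (Li r a * ((a ^ n) ^ Suc j / real (Suc j) ^ (p + q - r)) - a * euler_term p q n a r (Suc j)))" for j
  proof -
    have "n * Suc j \<ge> 1" using n by simp
    have l: "(- 1) ^ l * Li l a / real (Suc j) ^ m = (- 1) ^ l * Li l a * (1 / real (Suc j) ^ m)" for l m
      by simp
    have r: "a ^ (n * Suc j) * (Li r a - Li_trunc r a (n * Suc j)) / real (Suc j) ^ (p + q - r)
        = Li r a * ((a ^ n) ^ Suc j / real (Suc j) ^ (p + q - r)) - a * euler_term p q n a r (Suc j)" for r
    proof -
      have "a * euler_term p q n a r (Suc j)
          = (a * a) * (a ^ (n * Suc j) * Li_trunc r a (n * Suc j) / real (Suc j) ^ (p + q - r))"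
        unfolding euler_term_eq_Li_trunc[OF a] by (simp only: mult.assoc)
      then show ?thesis
        unfolding sign_powers(3)[OF a] power_mult
        by (simp add: right_diff_distrib diff_divide_distrib mult.commute del: power_Suc of_nat_Suc)
    qed
    show ?thesis
      unfolding shifted_Li_series_eq[OF a q p \<open>n * Suc j \<ge> 1\<close>] scale l r ..
  qed
  show ?thesis
    unfolding eq
  proof (intro sums_add sums_mult sums_sum sums_diff)
    show "(\<lambda>j. 1 / real (Suc j) ^ (p + q - l)) sums Li (p + q - l) 1" if "l \<in> {1..q}" for l
      using that p by (intro sums_inverse_power) auto
    show "(\<lambda>j. (a ^ n) ^ Suc j / real (Suc j) ^ (p + q - r)) sums Li (p + q - r) (a ^ n)" if "r \<in> {1..p}" for r
      using that q by (intro Li_sums sign_powers[OF a]) auto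
    show "(\<lambda>j. euler_term p q n a r (Suc j)) sums euler_sum p q n a r" if "r \<in> {1..p}" for r
      unfolding euler_sum_def euler_term_eq_Li_trunc[OF a] using that q
      by (intro summable_sums summable_mult summable_euler_term a) auto
  qed
qed

text \<open>The terms \<open>l = 1\<close> and \<open>r = 1\<close> combine to the summand with \<open>Li 1 a\<close>, and \<open>l = q\<close> is
  the one with \<open>Li q a * zeta p\<close>; the factors \<open>(- 1) ^ q\<close> and \<open>(- 1) ^ (p - 1)\<close> cancel because
  \<open>p + q\<close> is odd.\<close>

lemma has_integral_ln_Li:
  fixes p q n :: nat and a :: real
  assumes p: "p \<ge> 2" and q: "q \<ge> 2" and n: "n \<ge> 1" and a: "a \<in> {1, - 1}" and odd: "odd (p + q)"
  shows
    "((\<lambda>x. ln x ^ (p - 1) * Li q (a * x) / (x * (1 - x ^ n))) has_integral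
       (- fact (p - 1) * (\<Sum>r = 1..p. a / real n ^ (p + q - r)
            * real ((p + q - r - 1) choose (p - r)) * euler_sum p q n a r)
        + fact (p - 1) * (\<Sum>r = 2..p. 1 / real n ^ (p + q - r)
            * real ((p + q - r - 1) choose (p - r)) * Li r a * Li (p + q - r) (a ^ n))
        + fact (p - 1) * (\<Sum>l = 2..q - 1. (- 1) ^ l / real n ^ (p + q - l)
            * real ((p + q - l - 1) choose (q - l)) * Li l a * zeta (real (p + q - l)))
        - fact (p - 1) / real n ^ (p + q - 1) * real ((p + q - 2) choose (q - 1)) * Li 1 a
            * (zeta (real (p + q - 1)) - Li (p + q - 1) (a ^ n))
        - (- 1) ^ p * fact (p - 1) / real n ^ p
            * (real n ^ p * Li (p + q) a + Li q a * zeta (real p)))) {0<..<1}"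
proof -
  define f where "f = (fact (p - 1) :: real)"
  define \<sigma> where "\<sigma> = (- 1 :: real) ^ q"
  have sgn: "(- 1 :: real) ^ p = - \<sigma>" "(- 1 :: real) ^ (p - 1) = \<sigma>" "\<sigma> * \<sigma> = 1"
  proof -
    show *: "(- 1 :: real) ^ p = - \<sigma>"
      using odd by (cases "even q") (auto simp: \<sigma>_def)
    then show "(- 1 :: real) ^ (p - 1) = \<sigma>"
      using p by (cases p) auto
    show "\<sigma> * \<sigma> = 1" by (simp add: \<sigma>_def flip: power_mult_distrib)
  qed
  define P where "P r = 1 / real n ^ (p + q - r) * real ((p + q - r - 1) choose (p - r)) * Li r a * Li (p + q - r) (a ^ n)" for r
  define E where "E r = a / real n ^ (p + q - r) * real ((p + q - r - 1) choose (p - r)) * euler_sum p q n a r" for r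
  define Z where "Z l = (- 1) ^ l / real n ^ (p + q - l) * real ((p + q - l - 1) choose (q - l)) * Li l a * Li (p + q - l) 1" for l
  have choose_r: "(p + q - r - 1) choose (q - 1) = (p + q - r - 1) choose (p - r)" if "r \<in> {1..p}" for r
  proof -
    have "p + q - r - 1 - (q - 1) = p - r" "q - 1 \<le> p + q - r - 1" using that q by auto
    then show ?thesis using binomial_symmetric[of "q - 1" "p + q - r - 1"] by simp
  qed
  have choose_l: "(p + q - l - 1) choose (p - 1) = (p + q - l - 1) choose (q - l)" if "l \<in> {1..q}" for l
  proof -
    have "p + q - l - 1 - (p - 1) = q - l" "p - 1 \<le> p + q - l - 1" using that p by auto
    then show ?thesis using binomial_symmetric[of "p - 1" "p + q - l - 1"] by simp
  qed
  have sum_l: "(\<Sum>l = 1..q. real ((p + q - l - 1) choose (p - 1)) / real n ^ (p + q - l)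
        * ((- 1) ^ l * Li l a * Li (p + q - l) 1)) = (\<Sum>l = 1..q. Z l)"
  proof (intro sum.cong refl)
    fix l assume "l \<in> {1..q}"
    from choose_l[OF this] show "real ((p + q - l - 1) choose (p - 1)) / real n ^ (p + q - l)
        * ((- 1) ^ l * Li l a * Li (p + q - l) 1) = Z l"
      unfolding Z_def by simp
  qed
  have sum_r: "(\<Sum>r = 1..p. real ((p + q - r - 1) choose (q - 1)) / real n ^ (p + q - r)
        * (Li r a * Li (p + q - r) (a ^ n) - a * euler_sum p q n a r)) = (\<Sum>r = 1..p. P r) - (\<Sum>r = 1..p. E r)"
    unfolding sum_subtractf[symmetric]
  proof (intro sum.cong refl)
    fix r assume "r \<in> {1..p}"
    from choose_r[OF this] show "real ((p + q - r - 1) choose (q - 1)) / real n ^ (p + q - r)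
        * (Li r a * Li (p + q - r) (a ^ n) - a * euler_sum p q n a r) = P r - E r"
      unfolding P_def E_def by (simp add: right_diff_distrib mult_ac)
  qed
  obtain I where I: "(\<lambda>j. \<sigma> * f * shifted_Li_series p q a (n * j)) sums I"
    and int: "((\<lambda>x. ln x ^ (p - 1) * Li q (a * x) / (x * (1 - x ^ n))) has_integral I) {0<..<1}"
    using has_integral_ln_Li_geometric[OF a q n p] unfolding sgn f_def by blast
  have "(\<lambda>j. shifted_Li_series p q a (n * Suc j)) sums (\<sigma> * (\<Sum>l = 1..q. Z l) + \<sigma> * ((\<Sum>r = 1..p. P r) - (\<Sum>r = 1..p. E r)))"
    using shifted_Li_series_multiples_sums[OF a q p n] unfolding sum_l sum_r \<sigma>_def .
  then have "(\<lambda>j. \<sigma> * f * shifted_Li_series p q a (n * Suc j)) sums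
      (\<sigma> * f * (\<sigma> * (\<Sum>l = 1..q. Z l) + \<sigma> * ((\<Sum>r = 1..p. P r) - (\<Sum>r = 1..p. E r))))"
    by (rule sums_mult)
  then have "(\<lambda>j. \<sigma> * f * shifted_Li_series p q a (n * j)) sums
      (\<sigma> * f * (\<sigma> * (\<Sum>l = 1..q. Z l) + \<sigma> * ((\<Sum>r = 1..p. P r) - (\<Sum>r = 1..p. E r)))
        + \<sigma> * f * shifted_Li_series p q a (n * 0))"
    by (subst (asm) sums_Suc_iff[of "\<lambda>j. \<sigma> * f * shifted_Li_series p q a (n * j)"]) simp
  then have "I = (\<sigma> * \<sigma>) * f * ((\<Sum>l = 1..q. Z l) + (\<Sum>r = 1..p. P r) - (\<Sum>r = 1..p. E r)) + \<sigma> * f * Li (p + q) a"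
    using sums_unique2[OF I] shifted_Li_series_0[OF a q, of p] by (simp add: algebra_simps)
  then have I_eq: "I = f * ((\<Sum>l = 1..q. Z l) + (\<Sum>r = 1..p. P r) - (\<Sum>r = 1..p. E r)) + \<sigma> * f * Li (p + q) a"
    unfolding sgn by simp
  define Y where "Y = 1 / real n ^ (p + q - 1) * real ((p + q - 2) choose (q - 1)) * Li 1 a
            * (zeta (real (p + q - 1)) - Li (p + q - 1) (a ^ n))"
  have Z_split: "(\<Sum>l = 1..q. Z l) = Z 1 + (\<Sum>l = 2..q - 1. Z l) + Z q"
  proof -
    obtain q' where q': "q = Suc q'" "q' \<ge> 1" using q by (cases q) auto
    then show ?thesis by (simp add: sum.atLeast_Suc_atMost numeral_2_eq_2)
  qed
  have P_split: "(\<Sum>r = 1..p. P r) = P 1 + (\<Sum>r = 2..p. P r)"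
    using p by (simp add: sum.atLeast_Suc_atMost numeral_2_eq_2)
  have Z_1: "Z 1 = - Y - P 1"
  proof -
    have "(p + q - 1 - 1) choose (p - 1) = (p + q - 2) choose (q - 1)"
      using choose_r[of 1] p by (simp add: numeral_2_eq_2)
    moreover have "zeta (real (p + q - 1)) = Li (p + q - 1) 1"
      using p q by (intro zeta_eq_Li) auto
    ultimately show ?thesis
      by (simp add: Y_def Z_def P_def numeral_2_eq_2 algebra_simps diff_divide_distrib)
  qed
  have "I = - f * (\<Sum>r = 1..p. E r) + f * (\<Sum>r = 2..p. P r) + f * (\<Sum>l = 2..q - 1. Z l)
        - f * Y + f * Z q + \<sigma> * f * Li (p + q) a"
    unfolding I_eq Z_split P_split Z_1 by (simp add: algebra_simps)
  also have "(\<Sum>l = 2..q - 1. Z l) = (\<Sum>l = 2..q - 1. (- 1) ^ l / real n ^ (p + q - l)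
            * real ((p + q - l - 1) choose (q - l)) * Li l a * zeta (real (p + q - l)))"
  proof (intro sum.cong refl)
    fix l assume "l \<in> {2..q - 1}"
    then have "zeta (real (p + q - l)) = Li (p + q - l) 1"
      using p by (intro zeta_eq_Li) auto
    then show "Z l = (- 1) ^ l / real n ^ (p + q - l)
            * real ((p + q - l - 1) choose (q - l)) * Li l a * zeta (real (p + q - l))"
      by (simp only: Z_def)
  qed
  also have "Z q = \<sigma> / real n ^ p * (Li q a * zeta (real p))"
    using p by (simp add: Z_def \<sigma>_def zeta_eq_Li)
  also have "- f * (\<Sum>r = 1..p. E r) + f * (\<Sum>r = 2..p. P r)
        + f * (\<Sum>l = 2..q - 1. (- 1) ^ l / real n ^ (p + q - l)
            * real ((p + q - l - 1) choose (q - l)) * Li l a * zeta (real (p + q - l)))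
        - f * Y + f * (\<sigma> / real n ^ p * (Li q a * zeta (real p))) + \<sigma> * f * Li (p + q) a
      = - f * (\<Sum>r = 1..p. E r) + f * (\<Sum>r = 2..p. P r)
        + f * (\<Sum>l = 2..q - 1. (- 1) ^ l / real n ^ (p + q - l)
            * real ((p + q - l - 1) choose (q - l)) * Li l a * zeta (real (p + q - l)))
        - f / real n ^ (p + q - 1) * real ((p + q - 2) choose (q - 1)) * Li 1 a
            * (zeta (real (p + q - 1)) - Li (p + q - 1) (a ^ n))
        - (- \<sigma>) * f / real n ^ p * (real n ^ p * Li (p + q) a + Li q a * zeta (real p))"
    using n by (simp add: Y_def distrib_left mult_ac)
  finally show ?thesis
    using int unfolding f_def P_def E_def sgn by simp
qed

theorem theorem2:
  fixes p q n :: nat and a :: real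
  assumes "p \<ge> 2" and "q \<ge> 2" and "n \<ge> 1" and "a \<in> {1, - 1}" and "odd (p + q)"
  shows
    "((\<lambda>x. ln x ^ (p - 1) * Li q (a * x) / (x * (1 - x ^ n))) has_integral
       (- fact (p - 1) * (\<Sum>r = 1..p. a / real n ^ (p + q - r)
            * real ((p + q - r - 1) choose (p - r)) * euler_sum p q n a r)
        + fact (p - 1) * (\<Sum>r = 2..p. 1 / real n ^ (p + q - r)
            * real ((p + q - r - 1) choose (p - r)) * Li r a * Li (p + q - r) (a ^ n))
        + fact (p - 1) * (\<Sum>l = 2..q - 1. (- 1) ^ l / real n ^ (p + q - l)
            * real ((p + q - l - 1) choose (q - l)) * Li l a * zeta (real (p + q - l)))
        - fact (p - 1) / real n ^ (p + q - 1) * real ((p + q - 2) choose (q - 1)) * Li 1 a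
            * (zeta (real (p + q - 1)) - Li (p + q - 1) (a ^ n))
        - (- 1) ^ p * fact (p - 1) / real n ^ p
            * (real n ^ p * Li (p + q) a + Li q a * zeta (real p)))) {0<..<1}
     \<and> (\<forall>r\<in>{1..p}. let s = p + q - r in
         (\<lambda>m. euler_term p q n a r (Suc m)) sums
         (a / 2 * (1 + (- 1) ^ s) * Li s (a ^ n) * Li r a
          + a / (2 * real n ^ r) * Li (p + q) 1
          - (- 1) ^ s * real n ^ s * a * (\<Sum>i = 0..s div 2.
              real ((p + q - 2 * i - 1) choose (r - 1)) * (1 / real n ^ (2 * i))
              * Li (2 * i) 1 * Li (p + q - 2 * i) a)
          + (- 1) ^ r * a / real n ^ r * (\<Sum>i = 0..r div 2.
              real ((p + q - 2 * i - 1) choose (s - 1))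
              * Li (2 * i) 1 * Li (p + q - 2 * i) (a ^ n))
          + (- 1) ^ r * a ^ (n + 1) / (2 * real n ^ r) * (\<Sum>i = 1..n - 1. \<Sum>k = 1..r.
              real ((p + q - k - 1) choose (s - 1)) * a ^ i * (- 1) ^ k
              * Theta1 k i n * Lerch_Phi (a ^ n) (p + q - k) (real (n - i) / real n))))"
  unfolding Let_def
  by (intro conjI ballI has_integral_ln_Li euler_term_sums assms)

end
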